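(* Let $p\ge2$ and let $$\mu=w_0\mu_0+\sum_{j\ge1}w_j\mu_j,\qquad w_j\ge0,\quad\sum_{j\ge0}w_j=1,$$ where every $\mu_j$ ($j\ge0$) is a Borel probability measure on $\mathbb S^{p-1}$ supported on a compact set $K_j\subset\mathbb S^{p-1}$ whose orthogonality shadow $\mathcal O(K_j)$ is Haar-null. For $j\ge1$, suppose further that $$K_j\subset B(a_j,\rho_j),\qquad a_j\in\mathbb S^{p-1},\qquad 0<\rho_j\le\tfrac14,$$ where the balls use chordal distance, and that $$\sum_{j\ge1}\rho_j<\infty,\qquad\sum_{j\ge1}w_j\log\frac e{\rho_j}<\infty .$$ Then, for $U$ uniformly distributed on $\mathbb S^{p-1}$, $I_\mu(U)<\infty$ almost surely, and consequently $$\frac1{\|g_\mu(U)\|^2}=\{U^\top N_\mu(U)\}^2\sim\mathrm{Beta}\Bigl(\tfrac12,\tfrac{p-1}2\Bigr).$$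
   Context: For compact $K\subset\mathbb S^{p-1}$, the orthogonality shadow is $\mathcal O(K):=\{u\in\mathbb S^{p-1}:a^\top u=0\text{ for some }a\in K\}$. The chordal distance is the Euclidean distance of $\mathbb R^p$ restricted to the sphere. $I_\mu(u):=\int_{\mathbb S^{p-1}}|a^\top u|^{-1}\mu(\mathrm da)$ (integrand $+\infty$ when $a^\top u=0$); where it is finite, $g_\mu(u):=\int\frac{a}{a^\top u}\,\mu(\mathrm da)$ (which satisfies $u^\top g_\mu(u)=1$) and $N_\mu(u):=g_\mu(u)/\|g_\mu(u)\|$. *)

theory Defs
  imports "HOL-Probability.Probability"
begin

definition orthogonality_shadow :: "(real ^ 'n) set \<Rightarrow> (real ^ 'n) set" where
  "orthogonality_shadow K = {u \<in> sphere 0 1. \<exists>a\<in>K. a \<bullet> u = 0}"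

text \<open>
  The uniform distribution (normalised Haar measure) on the unit sphere: the normalised
  cone measure, i.e. the law of \<open>x / \<parallel>x\<parallel>\<close> for \<open>x\<close> uniform in the unit ball.  It is a Borel
  measure on the ambient space.  The two facts characterising it, concentration on the sphere
  and invariance under the orthogonal group, are proved below.
\<close>

definition sphere_uniform :: "(real ^ 'n) measure" where
  "sphere_uniform = distr (uniform_measure lborel (ball 0 1)) borel (\<lambda>x. x /\<^sub>R norm x)"

text \<open>Division in \<^typ>\<open>ennreal\<close>: \<open>1 / 0 = \<infinity>\<close>, so the integrand is \<open>\<infinity>\<close> when \<open>a \<bullet> u = 0\<close>.\<close>

definition inv_energy :: "(real ^ 'n) measure \<Rightarrow> real ^ 'n \<Rightarrow> ennreal" where
  "inv_energy \<mu> u = (\<integral>\<^sup>+ a. 1 / ennreal \<bar>a \<bullet> u\<bar> \<partial>\<mu>)"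

text \<open>
  \<open>g_field \<mu> u\<close> and \<open>N_field \<mu> u\<close> are meaningful only where \<open>inv_energy \<mu> u < \<infinity>\<close>; elsewhere
  they take default values (a non-integrable Bochner integral is \<open>0\<close>, and \<open>inverse 0 = 0\<close>).
\<close>

definition g_field :: "(real ^ 'n) measure \<Rightarrow> real ^ 'n \<Rightarrow> real ^ 'n" where
  "g_field \<mu> u = (\<integral> a. (1 / (a \<bullet> u)) *\<^sub>R a \<partial>\<mu>)"

definition N_field :: "(real ^ 'n) measure \<Rightarrow> real ^ 'n \<Rightarrow> real ^ 'n" where
  "N_field \<mu> u = g_field \<mu> u /\<^sub>R norm (g_field \<mu> u)"

definition beta_density :: "real \<Rightarrow> real \<Rightarrow> real \<Rightarrow> real" where
  "beta_density a b x =
     (if 0 < x \<and> x < 1 then x powr (a - 1) * (1 - x) powr (b - 1) / Beta a b else 0)"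

lemma inv_energy_integrand_zero: "a \<bullet> u = 0 \<Longrightarrow> 1 / ennreal \<bar>a \<bullet> u\<bar> = \<infinity>"
  by simp

lemma prob_space_uniform_ball:
  "prob_space (uniform_measure lborel (ball (0 :: real ^ 'n) 1))"
proof (rule prob_space_uniform_measure)
  show "emeasure lborel (ball (0 :: real ^ 'n) 1) \<noteq> 0"
    by (metis centre_in_ball empty_iff ennreal_0 measure_def content_ball_eq_0_iff enn2real_0 not_one_le_zero)
  show "emeasure lborel (ball (0 :: real ^ 'n) 1) \<noteq> \<infinity>"
    using emeasure_lborel_ball_finite[of "0 :: real ^ 'n" 1] by auto
qed

lemma sets_sphere_uniform [simp, measurable_cong]: "sets sphere_uniform = sets borel"
  by (simp add: sphere_uniform_def)

lemma prob_space_sphere_uniform: "prob_space sphere_uniform"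
  unfolding sphere_uniform_def
  by (intro prob_space.prob_space_distr prob_space_uniform_ball) simp

lemma AE_sphere_uniform: "AE u in (sphere_uniform :: (real ^ 'n) measure). u \<in> sphere 0 1"
proof -
  have "AE x in lborel. x \<noteq> (0 :: real ^ 'n)"
    by (rule AE_lborel_singleton)
  then have "AE x in uniform_measure lborel (ball (0 :: real ^ 'n) 1). x \<noteq> 0"
    unfolding uniform_measure_def
    by (subst AE_density) (auto intro!: borel_measurable_divide_ennreal borel_measurable_indicator)
  then have "AE x in uniform_measure lborel (ball (0 :: real ^ 'n) 1). norm (x /\<^sub>R norm x) = 1"
    by eventually_elim simp
  then show ?thesis
    unfolding sphere_uniform_def by (subst AE_distr_iff) auto
qed

lemma distr_lborel_orthogonal:
  fixes f :: "real ^ 'n \<Rightarrow> real ^ 'n"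
  assumes f: "orthogonal_transformation f"
  shows "distr lborel borel f = lborel"
proof -
  have bij: "bij f" and inv: "orthogonal_transformation (inv f)"
    using f by (auto intro: orthogonal_transformation_bij orthogonal_transformation_inv)
  have lin: "linear f" "linear (inv f)"
    using f inv by (auto intro: orthogonal_transformation_linear)
  have fm [measurable]: "f \<in> borel_measurable borel"
    using lin by (intro borel_measurable_continuous_onI) (simp add: linear_continuous_on linear_conv_bounded_linear)
  let ?M = "distr lborel borel f"
  have vim: "f -` A = inv f ` A" for A
    using bij by (simp add: bij_vimage_eq_inv_image)
  have M: "emeasure ?M A = emeasure lborel (inv f ` A)" if "A \<in> sets borel" for A
    using that by (subst emeasure_distr) (auto simp: vim)
  have balls: "emeasure ?M (ball c r) = emeasure lborel (ball c r)" if "r > 0" for c r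
    using that by (simp add: M image_orthogonal_transformation_ball[OF inv] emeasure_ball)
  have box: "emeasure ?M S = emeasure lborel S" if S: "open S" for S
  proof -
    define I where "I = {(x, r). 0 < r \<and> ball x r \<subseteq> S}"
    have "\<exists>i. i \<in> I \<and> x \<in> ball (fst i) (snd i) \<and> snd i < d" if "x \<in> S" "0 < d" for x d
    proof -
      obtain e where e: "0 < e" "ball x e \<subseteq> S"
        using S \<open>x \<in> S\<close> open_contains_ball by blast
      let ?r = "min e d / 2"
      have "ball x ?r \<subseteq> ball x e"
        using e \<open>0 < d\<close> by (intro subset_ball) auto
      then show ?thesis
        using e \<open>0 < d\<close> by (intro exI[of _ "(x, ?r)"]) (auto simp: I_def)
    qed
    then obtain C where C: "countable C" "C \<subseteq> I"
        and disj: "pairwise (\<lambda>i j. disjnt (ball (fst i) (snd i)) (ball (fst j) (snd j))) C"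
        and neg: "negligible (S - (\<Union>i\<in>C. ball (fst i) (snd i)))"
      by (rule Vitali_covering_theorem_balls[of S I fst snd])
    define B where "B = (\<Union>i\<in>C. ball (fst i) (snd i))"
    have B: "B \<in> sets borel"
      unfolding B_def by (intro borel_open open_UN ballI open_ball)
    have "ball (fst i) (snd i) \<subseteq> S" if "i \<in> C" for i
      using subsetD[OF C(2) that] unfolding I_def by (simp add: case_prod_beta)
    then have BS: "B \<subseteq> S"
      unfolding B_def by (rule UN_least)
    have D: "S - B \<in> sets borel"
      using B S by auto
    have df: "disjoint_family_on (\<lambda>i. ball (fst i) (snd i)) C"
      using disj by (auto simp: disjoint_family_on_def pairwise_def disjnt_def)
    have "emeasure ?M B = emeasure lborel B"
      unfolding B_def using C
      by (subst (1 2) emeasure_UN_countable[OF _ _ df]; (auto intro!: nn_integral_cong balls simp: I_def)?)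
    moreover have "emeasure lborel (S - B) = 0"
      using neg D by (simp add: B_def negligible_iff_null_sets null_sets_def)
    moreover have "emeasure ?M (S - B) = 0"
    proof -
      have "negligible (inv f ` (S - B))"
        using neg lin(2) unfolding B_def
        by (intro negligible_differentiable_image_negligible linear_imp_differentiable_on) auto
      moreover have "inv f ` (S - B) \<in> sets borel"
        using measurable_sets[OF fm D] by (simp add: vim)
      ultimately show ?thesis
        using D by (simp add: M negligible_iff_null_sets null_sets_def)
    qed
    moreover have "S = B \<union> (S - B)"
      using BS by auto
    ultimately show ?thesis
      using B D emeasure_Un_null_set[of B ?M "S - B"] emeasure_Un_null_set[of B lborel "S - B"]
      by (simp add: null_sets_def)
  qed
  have "lborel = ?M"
  proof (rule lborel_eqI)
    show "emeasure ?M (box l u) = (\<Prod>b\<in>Basis. (u - l) \<bullet> b)"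
      if "\<And>b. b \<in> Basis \<Longrightarrow> l \<bullet> b \<le> u \<bullet> b" for l u
      unfolding box[OF open_box] by (rule emeasure_lborel_box) (rule that)
    show "sets ?M = sets borel"
      by (rule sets_distr)
  qed
  then show ?thesis ..
qed

lemma sphere_uniform_orthogonal_invariant:
  fixes f :: "real ^ 'n \<Rightarrow> real ^ 'n"
  assumes f: "orthogonal_transformation f"
  shows "distr sphere_uniform borel f = sphere_uniform"
proof -
  let ?n = "\<lambda>x :: real ^ 'n. x /\<^sub>R norm x"
  let ?B = "ball (0 :: real ^ 'n) 1"
  have lin: "linear f" by (rule orthogonal_transformation_linear[OF f])
  have fm [measurable]: "f \<in> borel_measurable borel"
    using lin by (intro borel_measurable_continuous_onI) (simp add: linear_continuous_on linear_conv_bounded_linear)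
  have nm [measurable]: "?n \<in> borel_measurable borel" by simp
  have comm: "f (?n x) = ?n (f x)" for x
    using lin by (simp add: linear_cmul orthogonal_transformation_norm[OF f])
  have uni: "distr (uniform_measure lborel ?B) borel f = uniform_measure lborel ?B"
  proof -
    let ?d = "\<lambda>x. indicator ?B x / emeasure lborel ?B"
    have "uniform_measure lborel ?B = density (distr lborel borel f) ?d"
      by (simp add: uniform_measure_def distr_lborel_orthogonal[OF f])
    also have "\<dots> = distr (density lborel (\<lambda>x. ?d (f x))) borel f"
      by (rule density_distr) (auto intro!: borel_measurable_divide_ennreal borel_measurable_indicator)
    also have "(\<lambda>x. ?d (f x)) = ?d"
      by (auto simp: indicator_def orthogonal_transformation_norm[OF f])
    finally show ?thesis
      by (simp add: uniform_measure_def)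
  qed
  have "distr sphere_uniform borel f = distr (uniform_measure lborel ?B) borel (\<lambda>x. f (?n x))"
    unfolding sphere_uniform_def by (subst distr_distr) (auto simp: comp_def)
  also have "\<dots> = distr (distr (uniform_measure lborel ?B) borel f) borel ?n"
    by (subst distr_distr) (auto simp: comp_def comm)
  finally show ?thesis
    by (simp add: uni sphere_uniform_def)
qed

end

theory Submission
  imports Defs "HOL-Complex_Analysis.Cauchy_Integral_Formula" "HOL-Real_Asymp.Real_Asymp"
begin

text \<open>
  Write \<open>g\<close> for \<open>g_field \<mu>\<close>. Assume first that the energy of \<open>\<mu>\<close>, a probability measure on the
  sphere, is finite almost everywhere. The law of \<open>\<parallel>g(U)\<parallel>\<close> is then the same for all such \<open>\<mu>\<close>,
  because of a fact about Gaussian vectors: for independent standard Gaussian \<open>X\<close> and \<open>Y\<close> in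
  \<open>\<real>\<^sup>n\<close> the variable
  \<open>X \<bullet> g(Y) = \<integral> (a \<bullet> X) / (a \<bullet> Y) \<mu>(da)\<close> is standard Cauchy, whatever \<open>\<mu>\<close> is. To see this,
  replace \<open>(X, Y)\<close> by \<open>(c X + s Y, c Y - s X)\<close>, where \<open>c = cos \<theta>\<close> and \<open>s = sin \<theta>\<close>; the law of the
  pair does not change. In polar form
  \<open>a \<bullet> Y + \<i> (a \<bullet> X) = r\<^sub>a exp(\<i> \<phi>\<^sub>a)\<close>, the rotated variable is \<open>\<integral> tan(\<phi>\<^sub>a + \<theta>) \<mu>(da)\<close>, a boundary
  value, at \<open>w = exp(2 \<i> \<theta>)\<close>, of a holomorphic map from the unit disc to the closed upper half
  plane that takes \<open>0\<close> to \<open>\<i>\<close>. For \<open>t \<ge> 0\<close> the mean value property of \<open>exp(\<i> t F)\<close> for such a map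
  \<open>F\<close> gives the average \<open>exp(- t)\<close> over \<open>\<theta>\<close> (\<open>boundary_cauchy\<close>, \<open>cauchy_along_rotations\<close>).

  Integrating out \<open>X\<close> alone gives \<open>E exp(- t\<^sup>2 \<parallel>g(Y)\<parallel>\<^sup>2 / 2) = exp(- t)\<close>
  (\<open>laplace_norm_g_field\<close>). Integrating this against \<open>t\<^bsup>2k+1\<^esup> dt\<close> yields every moment of
  \<open>1 / \<parallel>g(Y)\<parallel>\<^sup>2\<close>. This variable is homogeneous of degree two in \<open>Y\<close>, and the norm and the
  direction of \<open>Y\<close> are independent, so that division by a moment of \<open>\<parallel>Y\<parallel>\<close> gives the moments of
  \<open>1 / \<parallel>g(U)\<parallel>\<^sup>2\<close> on the sphere (\<open>sphere_moment_g_field\<close>). They are the moments of the Beta law.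
  Since \<open>u \<bullet> g(u) = 1\<close>, the variable takes values in \<open>[0, 1]\<close>, and there moments determine the law
  (\<open>bounded_moment_determinacy\<close>). The same identity \<open>u \<bullet> g(u) = 1\<close> shows
  \<open>u \<bullet> N(u) = 1 / \<parallel>g(u)\<parallel>\<close>.

  It remains to bound the energy of the mixture (\<open>inv_energy_mixture_finite\<close>). By Borel-Cantelli
  and \<open>\<Sum> \<rho>\<^sub>j < \<infinity>\<close>, almost every \<open>y\<close> satisfies \<open>\<bar>a\<^sub>j \<bullet> y\<bar> \<ge> 2 \<rho>\<^sub>j\<close> for all large \<open>j\<close>. For such \<open>j\<close> the
  cap \<open>K\<^sub>j\<close> sees \<open>y\<close> essentially as its centre does, and its energy is at most
  \<open>2 / max \<rho>\<^sub>j \<bar>a\<^sub>j \<bullet> y\<bar>\<close>, whose mean is at most a constant times \<open>ln (e / \<rho>\<^sub>j)\<close>; these terms are summable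
  against the weights. Each of the finitely many other terms is finite off the orthogonality
  shadow of \<open>K\<^sub>j\<close>.
\<close>

section \<open>The standard Gaussian measure\<close>

definition gauss :: "(real ^ 'n) measure" where
  "gauss = density lborel (\<lambda>x. \<Prod>b\<in>Basis. ennreal (std_normal_density (x \<bullet> b)))"

lemma sets_gauss [simp, measurable_cong]: "sets gauss = sets borel"
  by (simp add: gauss_def)

lemma space_gauss [simp]: "space gauss = UNIV"
  by (simp add: gauss_def)

text \<open>
  The density is a function of the norm, which makes the measure invariant under orthogonal maps.
\<close>

lemma gauss_density_radial:
  "(\<Prod>b\<in>Basis. ennreal (std_normal_density (x \<bullet> b)))
     = ennreal ((1 / sqrt (2 * pi)) ^ CARD('n) * exp (- (norm x)\<^sup>2 / 2))" for x :: "real ^ 'n"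
proof -
  have "(\<Prod>b\<in>(Basis::(real^'n) set). ennreal (std_normal_density (x \<bullet> b)))
      = ennreal (\<Prod>b\<in>(Basis::(real^'n) set). std_normal_density (x \<bullet> b))"
    by (intro prod_ennreal) auto
  also have "(\<Prod>b\<in>(Basis::(real^'n) set). std_normal_density (x \<bullet> b))
      = (1 / sqrt (2 * pi)) ^ CARD('n) * exp (\<Sum>b\<in>Basis. - (x \<bullet> b)\<^sup>2 / 2)"
    unfolding std_normal_density_def exp_sum[OF finite_Basis] prod.distrib by simp
  also have "(\<Sum>b\<in>Basis. - (x \<bullet> b)\<^sup>2 / 2) = - (norm x)\<^sup>2 / 2"
    unfolding power2_norm_eq_inner
    by (subst euclidean_inner) (simp add: sum_negf sum_divide_distrib power2_eq_square)
  finally show ?thesis .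
qed

lemma gauss_eq: "(gauss :: (real ^ 'n) measure) =
    density lborel (\<lambda>x. ennreal ((1 / sqrt (2 * pi)) ^ CARD('n) * exp (- (norm x)\<^sup>2 / 2)))"
  unfolding gauss_def gauss_density_radial ..

lemma nn_integral_std_normal: "(\<integral>\<^sup>+x. ennreal (std_normal_density x) \<partial>lborel) = 1"
  by (subst nn_integral_eq_integral) (auto)

text \<open>
  In the direction of a basis vector the integral factorises, and the remaining factors are \<open>1\<close>.
\<close>

lemma nn_integral_gauss_Basis:
  fixes e :: "real ^ 'n"
  assumes [measurable]: "\<phi> \<in> borel_measurable borel" and e: "e \<in> Basis"
    and nonneg: "\<And>t. 0 \<le> \<phi> t"
  shows "(\<integral>\<^sup>+x. ennreal (\<phi> (e \<bullet> x)) \<partial>gauss) = (\<integral>\<^sup>+t. ennreal (\<phi> t) \<partial>std_normal_distribution)"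
proof -
  define f :: "real ^ 'n \<Rightarrow> real \<Rightarrow> real"
    where "f b t = (if b = e then \<phi> t else 1) * std_normal_density t" for b t
  have f: "ennreal (f b t) = (if b = e then ennreal (\<phi> t) else 1) * ennreal (std_normal_density t)" for b t
    by (simp add: f_def ennreal_mult nonneg)
  have "(\<integral>\<^sup>+x. ennreal (\<phi> (e \<bullet> x)) \<partial>gauss) = (\<integral>\<^sup>+x. (\<Prod>b\<in>Basis. ennreal (f b (x \<bullet> b))) \<partial>lborel)"
    unfolding gauss_def
  proof (subst nn_integral_density)
    show "(\<integral>\<^sup>+ x. (\<Prod>b\<in>(Basis::(real^'n) set). ennreal (std_normal_density (x \<bullet> b))) * ennreal (\<phi> (e \<bullet> x)) \<partial>lborel) =
      (\<integral>\<^sup>+ x. (\<Prod>b\<in>Basis. ennreal (f b (x \<bullet> b))) \<partial>lborel)"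
      using e by (simp add: f prod.distrib mult.commute inner_commute)
  qed (auto simp: inner_commute)
  also have "\<dots> = (\<Prod>b\<in>Basis. (\<integral>\<^sup>+t. ennreal (f b t) \<partial>lborel))"
    by (rule nn_integral_lborel_prod) (auto simp: f_def nonneg)
  also have "\<dots> = (\<Prod>b\<in>Basis. if b = e then (\<integral>\<^sup>+t. ennreal (\<phi> t) \<partial>std_normal_distribution) else 1)"
  proof (rule prod.cong[OF refl])
    fix b :: "real ^ 'n"
    show "(\<integral>\<^sup>+t. ennreal (f b t) \<partial>lborel) =
      (if b = e then (\<integral>\<^sup>+t. ennreal (\<phi> t) \<partial>std_normal_distribution) else 1)"
      by (auto simp: f_def nn_integral_std_normal nn_integral_density ennreal_mult nonneg mult.commute)
  qed
  also have "\<dots> = (\<integral>\<^sup>+t. ennreal (\<phi> t) \<partial>std_normal_distribution)"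
    using e by (simp add: prod.delta)
  finally show ?thesis .
qed

lemma prob_space_gauss: "prob_space (gauss :: (real ^ 'n) measure)"
proof
  have "emeasure (gauss :: (real ^ 'n) measure) UNIV = (\<Prod>b\<in>(Basis::(real^'n) set). (\<integral>\<^sup>+t. ennreal (std_normal_density t) \<partial>lborel))"
    unfolding gauss_def
    by (subst nn_integral_lborel_prod[symmetric]) (auto simp: emeasure_density)
  then show "emeasure (gauss :: (real ^ 'n) measure) (space gauss) = 1"
    by (simp add: nn_integral_std_normal)
qed

lemma gauss_orthogonal_invariant:
  fixes f :: "real ^ 'n \<Rightarrow> real ^ 'n"
  assumes f: "orthogonal_transformation f"
  shows "distr gauss borel f = gauss"
proof -
  have [measurable]: "f \<in> borel_measurable borel"
    using orthogonal_transformation_linear[OF f]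
    by (intro borel_measurable_continuous_onI) (simp add: linear_continuous_on linear_conv_bounded_linear)
  let ?d = "\<lambda>x::real^'n. ennreal ((1 / sqrt (2 * pi)) ^ CARD('n) * exp (- (norm x)\<^sup>2 / 2))"
  have "gauss = density (distr lborel borel f) ?d"
    by (simp add: gauss_eq distr_lborel_orthogonal[OF f])
  also have "\<dots> = distr (density lborel (\<lambda>x. ?d (f x))) borel f"
    by (rule density_distr) auto
  finally show ?thesis
    by (simp add: gauss_eq orthogonal_transformation_norm[OF f])
qed

text \<open>
  An orthogonal map carries a basis vector to \<open>a\<close>, which reduces the claim to one coordinate.
\<close>

lemma gauss_marginal:
  fixes a :: "real ^ 'n"
  assumes a: "norm a = 1"
  shows "distr gauss borel (\<lambda>x. a \<bullet> x) = std_normal_distribution"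
proof -
  obtain e :: "real ^ 'n" where e: "e \<in> Basis" using nonempty_Basis by blast
  obtain f where f: "orthogonal_transformation f" "f e = a"
    using orthogonal_transformation_exists[of e a] a e by auto
  have [measurable]: "f \<in> borel_measurable borel"
    using orthogonal_transformation_linear[OF f(1)]
    by (intro borel_measurable_continuous_onI) (simp add: linear_continuous_on linear_conv_bounded_linear)
  have "distr gauss borel (\<lambda>x. a \<bullet> x) = distr (distr gauss borel f) borel (\<lambda>x. a \<bullet> x)"
    by (simp add: gauss_orthogonal_invariant f)
  also have "\<dots> = distr gauss borel (\<lambda>x. e \<bullet> x)"
    using f by (subst distr_distr) (auto simp: comp_def orthogonal_transformation_def)
  also have "\<dots> = std_normal_distribution"
  proof (rule measure_eqI)
    fix A assume "A \<in> sets (distr gauss borel (\<lambda>x. e \<bullet> x))"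
    then have [measurable]: "A \<in> sets borel" by simp
    have "emeasure (distr gauss borel (\<lambda>x. e \<bullet> x)) A = (\<integral>\<^sup>+x. ennreal (indicator A (e \<bullet> x)) \<partial>gauss)"
      by (subst nn_integral_indicator[symmetric])
        (auto simp: nn_integral_distr ennreal_indicator simp del: nn_integral_indicator)
    also have "\<dots> = emeasure std_normal_distribution A"
      by (subst nn_integral_gauss_Basis) (auto simp: e ennreal_indicator)
    finally show "emeasure (distr gauss borel (\<lambda>x. e \<bullet> x)) A = emeasure std_normal_distribution A" .
  qed auto
  finally show ?thesis .
qed

lemma gauss_char:
  fixes v :: "real ^ 'n"
  shows "(\<integral>x. iexp (v \<bullet> x) \<partial>gauss) = complex_of_real (exp (- (norm v)\<^sup>2 / 2))"
proof (cases "v = 0")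
  case True
  interpret prob_space "gauss :: (real ^ 'n) measure" by (rule prob_space_gauss)
  show ?thesis using True prob_space by simp
next
  case False
  define a where "a = v /\<^sub>R norm v"
  have a: "norm a = 1" using False by (simp add: a_def)
  have v: "v \<bullet> x = norm v * (a \<bullet> x)" for x using False by (simp add: a_def)
  have "(\<integral>x. iexp (v \<bullet> x) \<partial>gauss) = char (distr gauss borel (\<lambda>x. a \<bullet> x)) (norm v)"
    unfolding char_def v by (subst integral_distr) (auto)
  then show ?thesis
    by (simp add: gauss_marginal[OF a] char_std_normal_distribution)
qed

section \<open>Rotating a pair of independent Gaussian vectors\<close>

text \<open>
  For a fixed second component a shear is a translation of the first one.
\<close>

lemma nn_integral_lborel_shear:
  fixes f :: "'a::euclidean_space \<times> 'a \<Rightarrow> ennreal"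
  assumes [measurable]: "f \<in> borel_measurable (borel \<Otimes>\<^sub>M borel)"
  shows "(\<integral>\<^sup>+z. f (fst z + t *\<^sub>R snd z, snd z) \<partial>(lborel \<Otimes>\<^sub>M lborel)) = (\<integral>\<^sup>+z. f z \<partial>(lborel \<Otimes>\<^sub>M lborel))"
    and "(\<integral>\<^sup>+z. f (fst z, snd z + t *\<^sub>R fst z) \<partial>(lborel \<Otimes>\<^sub>M lborel)) = (\<integral>\<^sup>+z. f z \<partial>(lborel \<Otimes>\<^sub>M lborel))"
proof -
  have tr: "(\<integral>\<^sup>+x. h (x + c) \<partial>lborel) = (\<integral>\<^sup>+x. h x \<partial>lborel)"
    if [measurable]: "h \<in> borel_measurable borel" for h :: "'a \<Rightarrow> ennreal" and c
    by (subst lborel_distr_plus[of c, symmetric]) (simp add: nn_integral_distr add.commute)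
  have "(\<integral>\<^sup>+z. f (fst z + t *\<^sub>R snd z, snd z) \<partial>(lborel \<Otimes>\<^sub>M lborel))
      = (\<integral>\<^sup>+y. \<integral>\<^sup>+x. f (x + t *\<^sub>R y, y) \<partial>lborel \<partial>lborel)"
    by (subst lborel_pair.nn_integral_snd[symmetric]) auto
  also have "\<dots> = (\<integral>\<^sup>+y. \<integral>\<^sup>+x. f (x, y) \<partial>lborel \<partial>lborel)"
    by (intro nn_integral_cong tr) auto
  finally show "(\<integral>\<^sup>+z. f (fst z + t *\<^sub>R snd z, snd z) \<partial>(lborel \<Otimes>\<^sub>M lborel)) = (\<integral>\<^sup>+z. f z \<partial>(lborel \<Otimes>\<^sub>M lborel))"
    by (simp add: lborel_pair.nn_integral_snd)
  have "(\<integral>\<^sup>+z. f (fst z, snd z + t *\<^sub>R fst z) \<partial>(lborel \<Otimes>\<^sub>M lborel))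
      = (\<integral>\<^sup>+x. \<integral>\<^sup>+y. f (x, y + t *\<^sub>R x) \<partial>lborel \<partial>lborel)"
    by (subst lborel.nn_integral_fst[symmetric]) auto
  also have "\<dots> = (\<integral>\<^sup>+x. \<integral>\<^sup>+y. f (x, y) \<partial>lborel \<partial>lborel)"
    by (intro nn_integral_cong tr) auto
  finally show "(\<integral>\<^sup>+z. f (fst z, snd z + t *\<^sub>R fst z) \<partial>(lborel \<Otimes>\<^sub>M lborel)) = (\<integral>\<^sup>+z. f z \<partial>(lborel \<Otimes>\<^sub>M lborel))"
    by (simp add: lborel.nn_integral_fst)
qed

text \<open>
  The block rotation of a pair of vectors; for \<open>c = cos \<theta>\<close> and \<open>s = sin \<theta>\<close> it multiplies the formal
  complex vector \<open>snd z + \<i> fst z\<close> by \<open>exp(\<i> \<theta>)\<close>.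
\<close>

definition rot :: "real \<Rightarrow> real \<Rightarrow> 'a::real_vector \<times> 'a \<Rightarrow> 'a \<times> 'a" where
  "rot c s z = (c *\<^sub>R fst z + s *\<^sub>R snd z, c *\<^sub>R snd z - s *\<^sub>R fst z)"

lemma measurable_rot [measurable]:
  "rot c s \<in> measurable (borel \<Otimes>\<^sub>M borel) (borel \<Otimes>\<^sub>M (borel :: 'a::euclidean_space measure))"
  unfolding rot_def by measurable

text \<open>
  A plane rotation other than the half turn is a product of three shears, with
  \<open>t = tan(\<theta> / 2) = s / (1 + c)\<close> in the two outer ones and \<open>- s\<close> in the middle one.
\<close>

lemma nn_integral_lborel_rot:
  fixes f :: "'a::euclidean_space \<times> 'a \<Rightarrow> ennreal"
  assumes f [measurable]: "f \<in> borel_measurable (borel \<Otimes>\<^sub>M borel)"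
    and cs: "c\<^sup>2 + s\<^sup>2 = 1" "c \<noteq> -1"
  shows "(\<integral>\<^sup>+z. f (rot c s z) \<partial>(lborel \<Otimes>\<^sub>M lborel)) = (\<integral>\<^sup>+z. f z \<partial>(lborel \<Otimes>\<^sub>M lborel))"
proof -
  define t where "t = s / (1 + c)"
  have "1 + c \<noteq> 0" using cs by linarith
  then have t1: "t * (1 + c) = s" by (simp add: t_def)
  then have tc: "t + t * c = s" by (simp add: algebra_simps)
  have "(1 - t * s - c) * (1 + c) = 1 - c\<^sup>2 - (t * (1 + c)) * s"
    by (simp add: algebra_simps power2_eq_square)
  also have "\<dots> = 0" unfolding t1 using cs by (simp add: power2_eq_square)
  finally have ts: "1 - t * s = c" using \<open>1 + c \<noteq> 0\<close> by simp
  let ?f1 = "\<lambda>z. f (fst z + t *\<^sub>R snd z, snd z)"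
  let ?f2 = "\<lambda>z. ?f1 (fst z, snd z + (- s) *\<^sub>R fst z)"
  have rot: "f (rot c s z) = ?f2 (fst z + t *\<^sub>R snd z, snd z)" for z
  proof -
    have "c *\<^sub>R fst z + s *\<^sub>R snd z = fst z + t *\<^sub>R snd z + t *\<^sub>R (snd z + (- s) *\<^sub>R (fst z + t *\<^sub>R snd z))"
    proof -
      have "fst z + t *\<^sub>R snd z + t *\<^sub>R (snd z + (- s) *\<^sub>R (fst z + t *\<^sub>R snd z))
          = (1 - t * s) *\<^sub>R fst z + (t *\<^sub>R snd z + (t * (1 - t * s)) *\<^sub>R snd z)"
        by (simp add: algebra_simps)
      then show ?thesis by (simp only: ts tc scaleR_add_left[symmetric])
    qed
    moreover have "c *\<^sub>R snd z - s *\<^sub>R fst z = snd z + (- s) *\<^sub>R (fst z + t *\<^sub>R snd z)"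
      by (subst ts[symmetric]) (simp add: algebra_simps)
    ultimately show ?thesis by (simp add: rot_def)
  qed
  have "(\<integral>\<^sup>+z. f (rot c s z) \<partial>(lborel \<Otimes>\<^sub>M lborel)) = (\<integral>\<^sup>+z. ?f2 z \<partial>(lborel \<Otimes>\<^sub>M lborel))"
    unfolding rot by (rule nn_integral_lborel_shear(1)[of ?f2]) measurable
  also have "\<dots> = (\<integral>\<^sup>+z. ?f1 z \<partial>(lborel \<Otimes>\<^sub>M lborel))"
    by (rule nn_integral_lborel_shear(2)[of ?f1]) measurable
  also have "\<dots> = (\<integral>\<^sup>+z. f z \<partial>(lborel \<Otimes>\<^sub>M lborel))"
    by (rule nn_integral_lborel_shear(1)) measurable
  finally show ?thesis .
qed

lemma gauss_pair_density:
  "(gauss :: (real ^ 'n) measure) \<Otimes>\<^sub>M (gauss :: (real ^ 'n) measure) = density (lborel \<Otimes>\<^sub>M lborel)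
     (\<lambda>z. ennreal ((1 / sqrt (2 * pi)) ^ CARD('n) * (1 / sqrt (2 * pi)) ^ CARD('n)
        * exp (- ((norm (fst z))\<^sup>2 + (norm (snd z))\<^sup>2) / 2)))"
proof -
  let ?d = "\<lambda>x::real^'n. ennreal ((1 / sqrt (2 * pi)) ^ CARD('n) * exp (- (norm x)\<^sup>2 / 2))"
  interpret prob_space "gauss :: (real ^ 'n) measure" by (rule prob_space_gauss)
  have "density lborel ?d \<Otimes>\<^sub>M density lborel ?d = density (lborel \<Otimes>\<^sub>M lborel) (\<lambda>(x, y). ?d x * ?d y)"
    using sigma_finite_measure_axioms
    by (intro pair_measure_density) (auto simp: gauss_eq lborel.sigma_finite_measure_axioms)
  also have "(\<lambda>(x, y). ?d x * ?d y) = (\<lambda>z. ennreal ((1 / sqrt (2 * pi)) ^ CARD('n) * (1 / sqrt (2 * pi)) ^ CARD('n)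
        * exp (- ((norm (fst z))\<^sup>2 + (norm (snd z))\<^sup>2) / 2)))"
    by (auto simp: fun_eq_iff ennreal_mult[symmetric] exp_add[symmetric] add_divide_distrib diff_divide_distrib mult_ac)
  finally show ?thesis unfolding gauss_eq .
qed

text \<open>
  The joint density depends only on \<open>\<parallel>x\<parallel>\<^sup>2 + \<parallel>y\<parallel>\<^sup>2\<close>, which a rotation preserves. The half turn is the
  square of the quarter turn.
\<close>

lemma gauss_pair_rot:
  assumes cs: "c\<^sup>2 + s\<^sup>2 = 1"
  shows "distr ((gauss :: (real ^ 'n) measure) \<Otimes>\<^sub>M gauss) (borel \<Otimes>\<^sub>M borel) (rot c s) = gauss \<Otimes>\<^sub>M gauss"
proof -
  let ?N = "(gauss :: (real ^ 'n) measure) \<Otimes>\<^sub>M gauss"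
  let ?B = "(borel :: (real ^ 'n) measure) \<Otimes>\<^sub>M borel"
  have sN [measurable_cong]: "sets ?N = sets ?B"
    by (intro sets_pair_measure_cong) auto
  have main: "distr ?N ?B (rot c s) = ?N" if cs: "c\<^sup>2 + s\<^sup>2 = 1" "c \<noteq> -1" for c s
  proof (rule measure_eqI)
    fix A assume "A \<in> sets (distr ?N ?B (rot c s))"
    then have [measurable]: "A \<in> sets ?B" by simp
    define h :: "(real ^ 'n) \<times> (real ^ 'n) \<Rightarrow> ennreal" where
      "h z = ennreal ((1 / sqrt (2 * pi)) ^ CARD('n) * (1 / sqrt (2 * pi)) ^ CARD('n)
        * exp (- ((norm (fst z))\<^sup>2 + (norm (snd z))\<^sup>2) / 2))" for z
    have [measurable]: "h \<in> borel_measurable ?B" unfolding h_def by measurable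
    have "(norm (c *\<^sub>R x + s *\<^sub>R y))\<^sup>2 + (norm (c *\<^sub>R y - s *\<^sub>R x))\<^sup>2 = (c\<^sup>2 + s\<^sup>2) * ((norm x)\<^sup>2 + (norm y)\<^sup>2)"
      for x y :: "real ^ 'n"
      unfolding power2_norm_eq_inner
      by (simp add: inner_add_left inner_add_right inner_diff_left inner_diff_right inner_commute
          algebra_simps power2_eq_square)
    then have h: "h (rot c s z) = h z" for z
      by (simp add: h_def rot_def cs)
    have "emeasure (distr ?N ?B (rot c s)) A = (\<integral>\<^sup>+z. indicator A (rot c s z) \<partial>?N)"
      by (subst nn_integral_indicator[symmetric]) (auto simp: nn_integral_distr simp del: nn_integral_indicator)
    also have "\<dots> = (\<integral>\<^sup>+z. h (rot c s z) * indicator A (rot c s z) \<partial>(lborel \<Otimes>\<^sub>M lborel))"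
      unfolding gauss_pair_density h_def[symmetric] h by (rule nn_integral_density) measurable
    also have "\<dots> = (\<integral>\<^sup>+z. h z * indicator A z \<partial>(lborel \<Otimes>\<^sub>M lborel))"
      by (rule nn_integral_lborel_rot[OF _ cs, of "\<lambda>z. h z * indicator A z"]) measurable
    also have "\<dots> = emeasure ?N A"
      unfolding gauss_pair_density h_def[symmetric] by (rule emeasure_density[symmetric]) measurable
    finally show "emeasure (distr ?N ?B (rot c s)) A = emeasure ?N A" .
  qed (simp add: sN)
  show ?thesis
  proof (cases "c = -1")
    case True
    then have "rot c s = rot 0 1 \<circ> (rot 0 1 :: _ \<Rightarrow> (real ^ 'n) \<times> (real ^ 'n))"
      using cs by (auto simp: rot_def fun_eq_iff)
    then have "distr ?N ?B (rot c s) = distr (distr ?N ?B (rot 0 1)) ?B (rot 0 1)"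
      by (subst distr_distr) auto
    then show ?thesis by (simp add: main)
  qed (use cs main in auto)
qed

section \<open>Polar coordinates for functions homogeneous of degree zero\<close>

lemma nn_integral_lborel_ball_scale:
  fixes G :: "'a::euclidean_space \<Rightarrow> ennreal"
  assumes [measurable]: "G \<in> borel_measurable borel"
    and deg0: "\<And>c x. 0 < c \<Longrightarrow> G (c *\<^sub>R x) = G x" and r: "0 < r"
  shows "(\<integral>\<^sup>+x. G x * indicator (ball 0 r) x \<partial>lborel)
       = ennreal (r ^ DIM('a)) * (\<integral>\<^sup>+x. G x * indicator (ball 0 1) x \<partial>lborel)"
proof -
  have ind: "indicator (ball 0 r) (r *\<^sub>R x) = (indicator (ball 0 1) x :: ennreal)" for x :: 'a
    using r by (auto simp: indicator_def mult_less_cancel_left_pos[of r _ 1, simplified])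
  have [measurable]: "ball (0::'a) s \<in> sets borel" for s by auto
  have "(\<integral>\<^sup>+x. G x * indicator (ball 0 r) x \<partial>lborel)
      = (\<integral>\<^sup>+x. ennreal (r ^ DIM('a)) * (G (r *\<^sub>R x) * indicator (ball 0 r) (r *\<^sub>R x)) \<partial>lborel)"
    using r by (subst lborel_affine[of r 0]) (auto simp: nn_integral_density nn_integral_distr)
  then show ?thesis
    by (simp add: ind deg0 r nn_integral_cmult)
qed

text \<open>
  Both sides are integrals of \<open>h\<close> against measures on the line. On \<open>{..<r}\<close> each of them gives
  \<open>r\<^sup>n\<close> times the integral of \<open>G\<close> over the unit ball: the first by scaling, the second by integrating
  \<open>n s\<^bsup>n-1\<^esup>\<close>. The bound on \<open>G\<close> makes these values finite, so that they determine the measure.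
\<close>

lemma nn_integral_polar:
  fixes G :: "'a::euclidean_space \<Rightarrow> ennreal" and h :: "real \<Rightarrow> ennreal"
  assumes [measurable]: "G \<in> borel_measurable borel" "h \<in> borel_measurable borel"
    and deg0: "\<And>c x. 0 < c \<Longrightarrow> G (c *\<^sub>R x) = G x" and le1: "\<And>x. G x \<le> 1"
  shows "(\<integral>\<^sup>+x. h (norm x) * G x \<partial>lborel) = (\<integral>\<^sup>+x. G x * indicator (ball 0 1) x \<partial>lborel)
     * (\<integral>\<^sup>+r. h r * (ennreal (DIM('a) * r ^ (DIM('a) - 1)) * indicator {0..} r) \<partial>lborel)"
proof -
  define C where "C = (\<integral>\<^sup>+x. G x * indicator (ball 0 1) x \<partial>lborel)"
  have [measurable]: "ball (0::'a) s \<in> sets borel" for s by auto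
  let ?d = "\<lambda>r::real. C * (ennreal (DIM('a) * r ^ (DIM('a) - 1)) * indicator {0..} r)"
  have C_fin: "C < \<infinity>"
  proof -
    have "C \<le> (\<integral>\<^sup>+x. indicator (ball 0 1) x \<partial>(lborel :: 'a measure))"
      unfolding C_def using le1 by (intro nn_integral_mono) (auto simp: indicator_def)
    also have "\<dots> < \<infinity>" using emeasure_lborel_ball_finite[of "0::'a" 1] by simp
    finally show ?thesis .
  qed
  have meas: "emeasure (distr (density lborel G) borel norm) {..<r} = (if 0 < r then ennreal (r ^ DIM('a)) * C else 0)" for r
  proof -
    have "emeasure (distr (density lborel G) borel norm) {..<r} = emeasure (density lborel G) (ball 0 r)"
      by (subst emeasure_distr) (auto intro!: arg_cong2[where f = emeasure])
    also have "\<dots> = (\<integral>\<^sup>+x. G x * indicator (ball 0 r) x \<partial>lborel)"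
      by (simp add: emeasure_density)
    also have "\<dots> = (if 0 < r then ennreal (r ^ DIM('a)) * C else 0)"
      using nn_integral_lborel_ball_scale[OF assms(1) deg0, of r] by (auto simp: C_def not_less ball_empty)
    finally show ?thesis .
  qed
  have meas': "emeasure (density lborel ?d) {..<r} = (if 0 < r then ennreal (r ^ DIM('a)) * C else 0)" for r
  proof -
    have "emeasure (density lborel ?d) {..<r} = (\<integral>\<^sup>+s. ?d s * indicator {..<r} s \<partial>lborel)"
      by (simp add: emeasure_density)
    also have "\<dots> = (\<integral>\<^sup>+s. C * (ennreal (DIM('a) * s ^ (DIM('a) - 1)) * indicator {0..r} s) \<partial>lborel)"
      using AE_lborel_singleton[of r] by (intro nn_integral_cong_AE) (auto split: split_indicator elim!: eventually_mono)
    also have "\<dots> = C * (\<integral>\<^sup>+s. (ennreal (DIM('a) * s ^ (DIM('a) - 1)) * indicator {0..r} s) \<partial>lborel)"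
      by (rule nn_integral_cmult) measurable
    also have "\<dots> = (if 0 < r then ennreal (r ^ DIM('a)) * C else 0)"
    proof (cases "0 < r")
      case True
      have "(\<integral>\<^sup>+s. (ennreal (DIM('a) * s ^ (DIM('a) - 1)) * indicator {0..r} s) \<partial>lborel)
          = ennreal (r ^ DIM('a) - 0 ^ DIM('a))"
        using True by (intro nn_integral_FTC_Icc) (auto intro!: derivative_eq_intros)
      then show ?thesis using True by (simp add: mult.commute zero_power)
    next
      case False
      have "(\<integral>\<^sup>+s. (ennreal (DIM('a) * s ^ (DIM('a) - 1)) * indicator {0..r} s) \<partial>lborel) = 0"
      proof (subst nn_integral_0_iff_AE)
        show "AE s in lborel. ennreal (DIM('a) * s ^ (DIM('a) - 1)) * indicator {0..r} s = 0"
          using AE_lborel_singleton[of "0::real"] by eventually_elim (use False in \<open>auto split: split_indicator\<close>)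
      qed measurable
      then show ?thesis using False by simp
    qed
    finally show ?thesis .
  qed
  have eq: "distr (density lborel G) borel norm = density lborel ?d"
  proof (rule measure_eqI_generator_eq[where A = "\<lambda>i. {..<real i}" and E = "range lessThan" and \<Omega> = UNIV])
    show "Int_stable (range lessThan :: real set set)"
    proof (rule Int_stableI)
      fix A B :: "real set" assume "A \<in> range lessThan" "B \<in> range lessThan"
      then obtain a b where "A = {..<a}" "B = {..<b}" by blast
      then have "A \<inter> B = {..<min a b}" by auto
      then show "A \<inter> B \<in> range lessThan" by blast
    qed
    show "(\<Union>i. {..<real i}) = UNIV"
      using reals_Archimedean2 by auto
    show "emeasure (distr (density lborel G) borel norm) {..<real i} \<noteq> \<infinity>" for i
      using C_fin by (auto simp: meas ennreal_mult_eq_top_iff)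
    show "sets (distr (density lborel G) borel norm) = sigma_sets UNIV (range lessThan)"
      "sets (density lborel ?d) = sigma_sets UNIV (range lessThan)"
      using arg_cong[OF borel_Iio[where 'a = real], of sets] by simp_all
  qed (auto simp only: meas meas')
  have "(\<integral>\<^sup>+x. h (norm x) * G x \<partial>lborel) = (\<integral>\<^sup>+r. h r \<partial>(distr (density lborel G) borel norm))"
    by (simp add: nn_integral_distr nn_integral_density mult.commute)
  also have "\<dots> = (\<integral>\<^sup>+r. C * (h r * (ennreal (DIM('a) * r ^ (DIM('a) - 1)) * indicator {0..} r)) \<partial>lborel)"
    unfolding eq by (simp add: nn_integral_density mult_ac)
  also have "\<dots> = C * (\<integral>\<^sup>+r. h r * (ennreal (DIM('a) * r ^ (DIM('a) - 1)) * indicator {0..} r) \<partial>lborel)"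
    by (rule nn_integral_cmult) measurable
  finally show ?thesis unfolding C_def .
qed

lemma emeasure_unit_ball:
  "emeasure lborel (ball (0 :: real ^ 'n) 1) \<noteq> 0" "emeasure lborel (ball (0 :: real ^ 'n) 1) \<noteq> \<infinity>"
proof -
  have "unit_ball_vol (real CARD('n)) \<noteq> 0" using unit_ball_vol_pos[of "real CARD('n)"] by linarith
  then show "emeasure lborel (ball (0 :: real ^ 'n) 1) \<noteq> 0" by (simp add: emeasure_ball)
qed (simp add: emeasure_ball)

lemma nn_integral_sphere_uniform:
  fixes G :: "real ^ 'n \<Rightarrow> ennreal"
  assumes [measurable]: "G \<in> borel_measurable borel"
    and deg0: "\<And>c x. 0 < c \<Longrightarrow> G (c *\<^sub>R x) = G x"
  shows "(\<integral>\<^sup>+u. G u \<partial>sphere_uniform)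
      = (\<integral>\<^sup>+x. G x * indicator (ball 0 1) x \<partial>lborel) / emeasure lborel (ball (0 :: real ^ 'n) 1)"
proof -
  have "(\<integral>\<^sup>+u. G u \<partial>sphere_uniform) = (\<integral>\<^sup>+x. G (x /\<^sub>R norm x) \<partial>uniform_measure lborel (ball (0 :: real ^ 'n) 1))"
    unfolding sphere_uniform_def by (rule nn_integral_distr) auto
  also have "\<dots> = (\<integral>\<^sup>+x. G (x /\<^sub>R norm x) * indicator (ball 0 1) x \<partial>lborel) / emeasure lborel (ball (0 :: real ^ 'n) 1)"
    by (rule nn_integral_uniform_measure) auto
  also have "(\<integral>\<^sup>+x. G (x /\<^sub>R norm x) * indicator (ball 0 1) x \<partial>lborel) = (\<integral>\<^sup>+x. G x * indicator (ball 0 1) x \<partial>lborel)"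
    using AE_lborel_singleton[of "0 :: real ^ 'n"]
    by (intro nn_integral_cong_AE) (auto simp: deg0 elim!: eventually_mono)
  finally show ?thesis .
qed

text \<open>
  The indicator of the exceptional set is homogeneous of degree zero. By polar coordinates it is null
  in the whole space as soon as it is null in the unit ball, which is what the uniform law on the
  sphere sees.
\<close>

lemma AE_lborel_cone_iff_AE_sphere_uniform:
  fixes P :: "real ^ 'n \<Rightarrow> bool"
  assumes [measurable]: "Measurable.pred borel P"
    and cone: "\<And>c x. 0 < c \<Longrightarrow> P (c *\<^sub>R x) = P x"
  shows "(AE x in lborel. P x) \<longleftrightarrow> (AE u in sphere_uniform. P u)"
    and "(AE x in lborel. norm x < 1 \<longrightarrow> P x) \<longleftrightarrow> (AE u in sphere_uniform. P u)"
proof -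
  define G :: "real ^ 'n \<Rightarrow> ennreal" where "G x = indicator {x. \<not> P x} x" for x
  have G [measurable]: "G \<in> borel_measurable borel" unfolding G_def by measurable
  have deg0: "0 < c \<Longrightarrow> G (c *\<^sub>R x) = G x" for c x by (simp add: G_def indicator_def cone)
  have [measurable]: "ball (0::real ^ 'n) s \<in> sets borel" for s by auto
  let ?I = "\<integral>\<^sup>+x. G x * indicator (ball 0 1) x \<partial>lborel"
  have "(AE u in sphere_uniform. P u) \<longleftrightarrow> (\<integral>\<^sup>+u. G u \<partial>sphere_uniform) = 0"
    by (subst nn_integral_0_iff_AE) (auto simp: G_def indicator_def)
  also have "\<dots> \<longleftrightarrow> ?I = 0"
    using emeasure_unit_ball[where 'n = 'n] by (simp add: nn_integral_sphere_uniform[OF G deg0])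
  finally have 1: "(AE u in sphere_uniform. P u) \<longleftrightarrow> ?I = 0" .
  have "(AE x in lborel. norm x < 1 \<longrightarrow> P x) \<longleftrightarrow> ?I = 0"
    by (subst nn_integral_0_iff_AE) (auto simp: G_def indicator_def)
  with 1 show "(AE x in lborel. norm x < 1 \<longrightarrow> P x) \<longleftrightarrow> (AE u in sphere_uniform. P u)" by simp
  show "(AE x in lborel. P x) \<longleftrightarrow> (AE u in sphere_uniform. P u)"
  proof
    assume "AE x in lborel. P x"
    then have "AE x in lborel. norm x < 1 \<longrightarrow> P x" by eventually_elim simp
    then show "AE u in sphere_uniform. P u"
      using \<open>(AE x in lborel. norm x < 1 \<longrightarrow> P x) \<longleftrightarrow> ?I = 0\<close> 1 by simp
  next
    assume "AE u in sphere_uniform. P u"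
    then have "?I = 0" using 1 by simp
    then have "(\<integral>\<^sup>+x. 1 * G x \<partial>lborel) = 0"
      by (subst nn_integral_polar[OF G _ deg0, of "\<lambda>_. 1"]) (auto simp: G_def indicator_def)
    then show "AE x in lborel. P x"
      by (subst (asm) nn_integral_0_iff_AE) (auto simp: G_def indicator_def split: if_splits)
  qed
qed

section \<open>Gaussian moments on the half line\<close>

text \<open>
  The closed form of \<open>\<integral>\<^sub>0\<^sup>\<infinity> t\<^sup>m exp(- t\<^sup>2 / 2) dt\<close>, see \<open>nn_integral_gauss_half_line\<close>.
\<close>

definition half_moment :: "nat \<Rightarrow> real" where
  "half_moment m = sqrt 2 ^ (m + 1) * (if even m then sqrt pi / 2 * (fact m / (2 ^ m * fact (m div 2)))
     else fact (m div 2) / 2)"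

lemma half_moment_pos: "0 < half_moment m"
  by (simp add: half_moment_def)

lemma half_moment_odd: "half_moment (2 * k + 1) = 2 ^ k * fact k"
proof -
  have "sqrt 2 ^ (2 * k + 2) = (2::real) ^ (k + 1)"
    using power_mult[of "sqrt 2" 2 "k + 1"] by (simp add: mult.commute)
  then show ?thesis by (simp add: half_moment_def)
qed

text \<open>
  For the integrals themselves this is integration by parts.
\<close>

lemma half_moment_rec: "half_moment (m + 2) = (m + 1) * half_moment m"
proof -
  define c :: "nat \<Rightarrow> real" where "c m = (if even m then sqrt pi / 2 * (fact m / (2 ^ m * fact (m div 2)))
     else fact (m div 2) / 2)" for m
  have hm: "half_moment m = sqrt 2 ^ (m + 1) * c m" for m
    by (simp add: half_moment_def c_def)
  have "c (m + 2) = (m + 1) / 2 * c m"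
  proof (cases "even m")
    case True
    then obtain k where "m = 2 * k" by blast
    then show ?thesis by (simp add: c_def divide_simps)
  next
    case False
    then obtain k where "m = 2 * k + 1" by (blast elim: oddE)
    then show ?thesis by (simp add: c_def field_simps)
  qed
  moreover have "sqrt 2 ^ (m + 2 + 1) = 2 * sqrt 2 ^ (m + 1)"
    by simp
  ultimately show ?thesis by (simp only: hm) simp
qed

lemma nn_integral_gauss_half_line:
  assumes q: "0 < q"
  shows "(\<integral>\<^sup>+t. ennreal (t ^ m * exp (- (t\<^sup>2 * q / 2))) * indicator {0..} t \<partial>lborel)
      = ennreal (half_moment m / sqrt q ^ (m + 1))"
proof -
  have P: "has_bochner_integral lborel (\<lambda>x::real. indicator {0..} x *\<^sub>R (exp (- x\<^sup>2) * x ^ m))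
       (half_moment m / sqrt 2 ^ (m + 1))"
  proof (cases "even m")
    case True
    then obtain k where m: "m = 2 * k" by blast
    show ?thesis using gaussian_moment_even_pos[of k] by (simp add: half_moment_def m)
  next
    case False
    then obtain k where m: "m = 2 * k + 1" by (blast elim: oddE)
    show ?thesis using gaussian_moment_odd_pos[of k] by (simp add: half_moment_def m)
  qed
  \<comment> \<open>The substitution \<open>t = c s\<close> turns \<open>t\<^sup>2 q / 2\<close> into
    \<open>s\<^sup>2\<close>.\<close>
  define c where "c = sqrt 2 / sqrt q"
  have c: "0 < c" using q by (simp add: c_def)
  have cc: "(c * x)\<^sup>2 * q / 2 = x\<^sup>2" for x using q by (simp add: c_def field_simps)
  have ind: "indicator {0..} (c * x) = (indicator {0..} x :: ennreal)" for x
    using c by (auto simp: indicator_def zero_le_mult_iff)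
  have "(\<integral>\<^sup>+t. ennreal (t ^ m * exp (- (t\<^sup>2 * q / 2))) * indicator {0..} t \<partial>lborel)
      = ennreal c * (\<integral>\<^sup>+t. ennreal ((c * t) ^ m * exp (- t\<^sup>2)) * indicator {0..} t \<partial>lborel)"
    using c by (subst nn_integral_real_affine[of _ c 0]) (auto simp: cc ind)
  also have "(\<integral>\<^sup>+t. ennreal ((c * t) ^ m * exp (- t\<^sup>2)) * indicator {0..} t \<partial>lborel)
      = (\<integral>\<^sup>+t. ennreal (c ^ m) * ennreal (indicator {0..} t *\<^sub>R (exp (- t\<^sup>2) * t ^ m)) \<partial>lborel)"
    using c by (intro nn_integral_cong) (auto simp: indicator_def ennreal_mult[symmetric] power_mult_distrib mult_ac)
  also have "\<dots> = ennreal (c ^ m) * ennreal (half_moment m / sqrt 2 ^ (m + 1))"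
    using P by (subst nn_integral_cmult) (auto simp: has_bochner_integral_iff nn_integral_eq_integral indicator_def)
  also have "ennreal c * (ennreal (c ^ m) * ennreal (half_moment m / sqrt 2 ^ (m + 1)))
      = ennreal (c ^ (m + 1) * (half_moment m / sqrt 2 ^ (m + 1)))"
    using c half_moment_pos[of m] by (simp add: ennreal_mult[symmetric] mult.assoc)
  also have "c ^ (m + 1) * (half_moment m / sqrt 2 ^ (m + 1)) = half_moment m / sqrt q ^ (m + 1)"
    by (simp add: c_def power_divide)
  finally show ?thesis .
qed

section \<open>Averages of the exponential over the boundary of the disc\<close>

text \<open>
  As a density of Lebesgue measure it has all Borel sets of the line as measurable sets, so functions
  on \<open>\<real>\<close> need not be restricted.
\<close>

definition uniform_01 :: "real measure" where
  "uniform_01 = density lborel (\<lambda>x. ennreal (indicator {0..1} x))"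

lemma sets_uniform_01 [simp, measurable_cong]: "sets uniform_01 = sets borel"
  by (simp add: uniform_01_def)

lemma space_uniform_01 [simp]: "space uniform_01 = UNIV"
  by (simp add: uniform_01_def)

lemma prob_space_uniform_01: "prob_space uniform_01"
proof
  show "emeasure uniform_01 (space uniform_01) = 1"
    by (simp add: uniform_01_def emeasure_density ennreal_indicator)
qed

text \<open>
  For a unimodular \<open>q = exp(2 \<i> \<phi>)\<close> and \<open>w = exp(2 \<i> \<theta>)\<close> the integrand is \<open>tan(\<phi> + \<theta>)\<close>.
  As a function of \<open>w\<close> it is a Moebius map from the disc onto the upper half plane.
\<close>

definition disc_cauchy :: "'a measure \<Rightarrow> ('a \<Rightarrow> complex) \<Rightarrow> complex \<Rightarrow> complex" where
  "disc_cauchy \<mu> q w = (\<integral>a. \<i> * (1 - q a * w) / (1 + q a * w) \<partial>\<mu>)"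

text \<open>
  Expanding the integrand in a geometric series gives a power series in \<open>w\<close> whose coefficients are
  moments of \<open>- q\<close> under \<open>\<mu>\<close>.
\<close>

lemma holomorphic_integral_geometric:
  fixes q :: "'a \<Rightarrow> complex"
  assumes "prob_space \<mu>" and [measurable]: "q \<in> borel_measurable \<mu>" and q: "\<And>a. norm (q a) = 1"
  shows "(\<lambda>w. \<integral>a. 1 / (1 + q a * w) \<partial>\<mu>) holomorphic_on ball 0 1"
proof (rule power_series_holomorphic)
  interpret prob_space \<mu> by fact
  fix w :: complex assume "w \<in> ball 0 1"
  then have w: "norm w < 1" by simp
  have n: "norm ((- q a) ^ k * w ^ k) = norm w ^ k" for a k
    by (simp add: norm_mult norm_power q)
  have i: "integrable \<mu> (\<lambda>a. (- q a) ^ k * w ^ k)" for k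
    by (rule integrable_const_bound[where B = "norm w ^ k"]) (simp_all only: n, auto)
  have geo: "(\<lambda>k. (- q a) ^ k * w ^ k) sums (1 / (1 + q a * w))" for a
    using geometric_sums[of "- q a * w"] w by (simp add: norm_mult q flip: power_mult_distrib)
  have "(\<lambda>k. \<integral>a. (- q a) ^ k * w ^ k \<partial>\<mu>) sums (\<integral>a. (\<Sum>k. (- q a) ^ k * w ^ k) \<partial>\<mu>)"
    by (rule sums_integral[OF i]) (simp_all only: n, use w prob_space in \<open>auto simp: summable_geometric\<close>)
  then show "(\<lambda>k. (\<integral>a. (- q a) ^ k \<partial>\<mu>) * (w - 0) ^ k) sums (\<integral>a. 1 / (1 + q a * w) \<partial>\<mu>)"
    by (simp add: sums_unique[OF geo, symmetric])
qed

lemma disc_cauchy_integrable: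
  fixes q :: "'a \<Rightarrow> complex"
  assumes "prob_space \<mu>" and [measurable]: "q \<in> borel_measurable \<mu>" and q: "\<And>a. norm (q a) = 1"
    and w: "norm w < 1"
  shows "integrable \<mu> (\<lambda>a. 1 / (1 + q a * w))"
    and "integrable \<mu> (\<lambda>a. \<i> * (1 - q a * w) / (1 + q a * w))"
proof -
  interpret prob_space \<mu> by fact
  have nz: "1 + q a * w \<noteq> 0" for a
  proof
    assume "1 + q a * w = 0"
    then have "q a * w = - 1" by (simp add: add_eq_0_iff)
    then have "norm (q a * w) = 1" by simp
    then show False using w by (simp add: norm_mult q)
  qed
  have "1 - norm w \<le> norm (1 + q a * w)" for a
    using norm_diff_ineq[of 1 "q a * w"] by (simp add: norm_mult q)
  then have "norm (1 / (1 + q a * w)) \<le> 1 / (1 - norm w)" for a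
    using w by (simp add: norm_divide frac_le)
  then show i: "integrable \<mu> (\<lambda>a. 1 / (1 + q a * w))"
    by (intro integrable_const_bound[where B = "1 / (1 - norm w)"]) auto
  have "\<i> * (1 - q a * w) / (1 + q a * w) = 2 * \<i> * (1 / (1 + q a * w)) - \<i>" for a
    using nz[of a] by (simp add: field_simps)
  then show "integrable \<mu> (\<lambda>a. \<i> * (1 - q a * w) / (1 + q a * w))"
    using integrable_mult_right[OF i, of "2 * \<i>"]
    by (simp only:) (intro Bochner_Integration.integrable_diff, auto)
qed

text \<open>
  With \<open>z = q a * w\<close>, the imaginary part of the integrand is \<open>(1 - \<bar>z\<bar>\<^sup>2) / \<bar>1 + z\<bar>\<^sup>2\<close>.
\<close>

lemma disc_cauchy_upper_half_plane:
  fixes q :: "'a \<Rightarrow> complex"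
  assumes "prob_space \<mu>" and [measurable]: "q \<in> borel_measurable \<mu>" and q: "\<And>a. norm (q a) = 1"
  shows "disc_cauchy \<mu> q holomorphic_on ball 0 1"
    and "disc_cauchy \<mu> q 0 = \<i>"
    and "norm w < 1 \<Longrightarrow> 0 \<le> Im (disc_cauchy \<mu> q w)"
proof -
  interpret prob_space \<mu> by fact
  have eq: "disc_cauchy \<mu> q w = 2 * \<i> * (\<integral>a. 1 / (1 + q a * w) \<partial>\<mu>) - \<i>" if w: "w \<in> ball 0 1" for w
  proof -
    have nz: "1 + q a * w \<noteq> 0" for a
    proof
      assume "1 + q a * w = 0"
      then have "q a * w = - 1" by (simp add: add_eq_0_iff)
      then have "norm (q a * w) = 1" by simp
      then show False using w by (simp add: norm_mult q)
    qed
    have "\<i> * (1 - q a * w) / (1 + q a * w) = 2 * \<i> * (1 / (1 + q a * w)) - \<i>" for a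
      using nz[of a] by (simp add: field_simps)
    then have "disc_cauchy \<mu> q w = (\<integral>a. 2 * \<i> * (1 / (1 + q a * w)) - \<i> \<partial>\<mu>)"
      by (simp add: disc_cauchy_def)
    also have "\<dots> = (\<integral>a. 2 * \<i> * (1 / (1 + q a * w)) \<partial>\<mu>) - (\<integral>a. \<i> \<partial>\<mu>)"
      using w by (intro Bochner_Integration.integral_diff integrable_mult_right disc_cauchy_integrable(1) assms) auto
    finally show ?thesis
      by (simp only: integral_mult_right_zero) (simp add: prob_space)
  qed
  show "disc_cauchy \<mu> q holomorphic_on ball 0 1"
    by (rule holomorphic_transform[of "\<lambda>w. 2 * \<i> * (\<integral>a. 1 / (1 + q a * w) \<partial>\<mu>) - \<i>"])
      (intro holomorphic_intros holomorphic_integral_geometric assms, simp add: eq)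
  show "disc_cauchy \<mu> q 0 = \<i>"
    by (simp add: disc_cauchy_def prob_space)
  assume w: "norm w < 1"
  have "0 \<le> Im (\<i> * (1 - z) / (1 + z))" if "norm z \<le> 1" for z :: complex
  proof -
    have "(norm z)\<^sup>2 \<le> 1" using that by (simp add: power_le_one)
    then have "(Re z)\<^sup>2 + (Im z)\<^sup>2 \<le> 1" by (simp add: cmod_power2)
    then have "0 \<le> ((1 - Re z) * (1 + Re z) - Im z * Im z)"
      by (simp add: algebra_simps power2_eq_square)
    then show ?thesis
      by (auto simp: Im_divide algebra_simps intro!: divide_nonneg_nonneg)
  qed
  then have "0 \<le> Im (\<i> * (1 - q a * w) / (1 + q a * w))" for a
    using w by (simp add: norm_mult q)
  then have "0 \<le> (\<integral>a. Im (\<i> * (1 - q a * w) / (1 + q a * w)) \<partial>\<mu>)"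
    by (intro integral_nonneg_AE) auto
  also have "\<dots> = Im (disc_cauchy \<mu> q w)"
    unfolding disc_cauchy_def by (rule integral_Im[OF disc_cauchy_integrable(2)[OF assms w]])
  finally show "0 \<le> Im (disc_cauchy \<mu> q w)" .
qed

lemma mean_value_circle:
  assumes f: "f holomorphic_on ball 0 1" and r: "0 < r" "r < 1"
  shows "(\<integral>x. f (of_real r * exp (2 * of_real pi * \<i> * of_real x)) \<partial>uniform_01) = f 0"
proof -
  let ?e = "\<lambda>x::real. of_real r * exp (2 * of_real pi * \<i> * of_real x)"
  have sub: "cball 0 r \<subseteq> ball (0::complex) 1" using r by auto
  have "((\<lambda>u. f u / (u - 0)) has_contour_integral (2 * of_real pi * \<i> * f 0)) (circlepath 0 r)"
    using f r by (intro Cauchy_integral_circlepath_simple holomorphic_on_subset[OF f sub]) auto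
  then have "((\<lambda>x. f (circlepath 0 r x) / (circlepath 0 r x - 0)
        * vector_derivative (circlepath 0 r) (at x within {0..1})) has_integral (2 * of_real pi * \<i> * f 0)) {0..1}"
    by (simp only: has_contour_integral_def)
  then have "((\<lambda>x. (2 * of_real pi * \<i>) * f (?e x)) has_integral ((2 * of_real pi * \<i>) * f 0)) {0..1}"
  proof (rule has_integral_eq[rotated])
    fix x :: real assume x: "x \<in> {0..1}"
    have "circlepath 0 r x = ?e x" by (simp add: circlepath)
    moreover have "vector_derivative (circlepath 0 r) (at x within {0..1}) = 2 * of_real pi * \<i> * ?e x"
      using x by (simp add: vector_derivative_circlepath01)
    moreover have "?e x \<noteq> 0" using r by simp
    ultimately show "f (circlepath 0 r x) / (circlepath 0 r x - 0)
        * vector_derivative (circlepath 0 r) (at x within {0..1}) = (2 * of_real pi * \<i>) * f (?e x)"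
      by simp
  qed
  from has_integral_mult_right[OF this, of "1 / (2 * of_real pi * \<i>)"]
  have hi: "((\<lambda>x. f (?e x)) has_integral f 0) {0..1}" by simp
  have cont: "continuous_on UNIV (\<lambda>x. f (?e x))"
  proof (rule continuous_on_compose2[OF holomorphic_on_imp_continuous_on[OF f]])
    show "continuous_on UNIV ?e" by (intro continuous_intros)
    show "range ?e \<subseteq> ball 0 1" using r by (auto simp: norm_mult)
  qed
  have [measurable]: "(\<lambda>x. f (?e x)) \<in> borel_measurable borel"
    by (rule borel_measurable_continuous_onI[OF cont])
  have si: "set_integrable lborel {0..1} (\<lambda>x. f (?e x))"
    unfolding set_integrable_def
    by (rule borel_integrable_compact) (auto intro: continuous_on_subset[OF cont])
  have "(\<integral>x. f (?e x) \<partial>uniform_01) = (LINT x:{0..1}|lborel. f (?e x))"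
    unfolding uniform_01_def set_lebesgue_integral_def by (rule integral_density) auto
  also have "\<dots> = f 0"
    using set_borel_integral_eq_integral(2)[OF si] hi by (simp add: integral_unique)
  finally show ?thesis .
qed

text \<open>
  For \<open>F = disc_cauchy \<mu> q\<close> the function \<open>exp(\<i> t F)\<close> is bounded by \<open>1\<close> in the disc and equals
  \<open>exp(- t)\<close> at the origin, so its average over every circle of radius \<open>r < 1\<close> is \<open>exp(- t)\<close>. The
  integrability hypothesis lets \<open>r\<close> tend to \<open>1\<close> under both integrals. In probabilistic terms: the
  boundary values of \<open>F\<close> have the characteristic function of the standard Cauchy law.
\<close>

lemma boundary_cauchy:
  fixes q :: "'a \<Rightarrow> complex"
  assumes "prob_space \<mu>" and [measurable]: "q \<in> borel_measurable \<mu>" and q: "\<And>a. norm (q a) = 1"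
    and bd: "AE x in uniform_01. (AE a in \<mu>. 1 + q a * exp (2 * of_real pi * \<i> * of_real x) \<noteq> 0) \<and>
       integrable \<mu> (\<lambda>a. 1 / norm (1 + q a * exp (2 * of_real pi * \<i> * of_real x)))"
    and t: "0 \<le> t"
  shows "(\<integral>x. exp (\<i> * of_real t * disc_cauchy \<mu> q (exp (2 * of_real pi * \<i> * of_real x))) \<partial>uniform_01)
       = exp (- of_real t)"
proof -
  interpret prob_space \<mu> by fact
  interpret u: prob_space uniform_01 by (rule prob_space_uniform_01)
  let ?e = "\<lambda>x::real. exp (2 * of_real pi * \<i> * of_real x) :: complex"
  let ?E = "\<lambda>w. exp (\<i> * of_real t * disc_cauchy \<mu> q w)"
  define r :: "nat \<Rightarrow> real" where "r n = 1 - 1 / (real n + 2)" for n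
  have r: "0 < r n" "r n < 1" for n by (auto simp: r_def field_simps)
  have r_lim: "r \<longlonglongrightarrow> 1"
    unfolding r_def by real_asymp
  have hol: "?E holomorphic_on ball 0 1"
    by (intro holomorphic_intros disc_cauchy_upper_half_plane assms)
  have bound: "norm (?E w) \<le> 1" if "norm w < 1" for w
    using disc_cauchy_upper_half_plane(3)[OF assms(1-3) that] t by simp
  have [measurable]: "(\<lambda>x. disc_cauchy \<mu> q (of_real s * ?e x)) \<in> borel_measurable borel" for s
    unfolding disc_cauchy_def by measurable
  have inner: "(\<lambda>n. disc_cauchy \<mu> q (of_real (r n) * ?e x)) \<longlonglongrightarrow> disc_cauchy \<mu> q (?e x)"
    if nz: "AE a in \<mu>. 1 + q a * ?e x \<noteq> 0" and i: "integrable \<mu> (\<lambda>a. 1 / norm (1 + q a * ?e x))" for x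
    unfolding disc_cauchy_def
  proof (rule integral_dominated_convergence)
    show "integrable \<mu> (\<lambda>a. 4 * (1 / norm (1 + q a * ?e x)))"
      by (rule integrable_mult_right[OF i])
    show "AE a in \<mu>. (\<lambda>n. \<i> * (1 - q a * (of_real (r n) * ?e x)) / (1 + q a * (of_real (r n) * ?e x)))
        \<longlonglongrightarrow> \<i> * (1 - q a * ?e x) / (1 + q a * ?e x)"
      using nz
    proof eventually_elim
      case (elim a)
      have "(\<lambda>n. \<i> * (1 - q a * (of_real (r n) * ?e x)) / (1 + q a * (of_real (r n) * ?e x)))
        \<longlonglongrightarrow> \<i> * (1 - q a * (of_real 1 * ?e x)) / (1 + q a * (of_real 1 * ?e x))"
        using elim by (intro tendsto_intros r_lim) auto
      then show ?case by simp
    qed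
    show "AE a in \<mu>. norm (\<i> * (1 - q a * (of_real (r n) * ?e x)) / (1 + q a * (of_real (r n) * ?e x)))
        \<le> 4 * (1 / norm (1 + q a * ?e x))" for n
      using nz
    proof eventually_elim
      case (elim a)
      define z where "z = q a * ?e x"
      have z: "norm z = 1" by (simp add: z_def norm_mult q)
      have "norm (1 - of_real (r n) * z) \<le> 1 + norm (of_real (r n) * z)"
        using norm_triangle_ineq4[of 1 "of_real (r n) * z"] by simp
      also have "\<dots> \<le> 2" using r[of n] z by (simp add: norm_mult)
      finally have num: "norm (1 - of_real (r n) * z) \<le> 2" .
      have "1 - r n \<le> norm (1 + of_real (r n) * z)"
        using norm_diff_ineq[of 1 "of_real (r n) * z"] r[of n] z by (simp add: norm_mult)
      moreover have "norm (1 + z) \<le> norm (1 + of_real (r n) * z) + norm (of_real (1 - r n) * z)"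
        using norm_triangle_ineq[of "1 + of_real (r n) * z" "of_real (1 - r n) * z"] by (simp add: algebra_simps)
      moreover have "norm (of_real (1 - r n) * z) = 1 - r n"
        using r[of n] z by (simp only: norm_mult norm_of_real) simp
      \<comment> \<open>The distance from \<open>- r z\<close> to 1 shrinks at most by the factor 2 as the
        point moves in from the circle, since \<open>norm (1 + r z) \<ge> 1 - r\<close>. This
        gives a bound that is uniform in the radius.\<close>
      ultimately have den: "norm (1 + z) / 2 \<le> norm (1 + of_real (r n) * z)" by simp
      have "norm (1 - of_real (r n) * z) / norm (1 + of_real (r n) * z) \<le> 2 / (norm (1 + z) / 2)"
        using num den elim by (intro frac_le) (auto simp: z_def)
      then show ?case by (simp add: z_def norm_mult norm_divide mult_ac)
    qed
  qed (auto intro!: borel_measurable_times borel_measurable_divide borel_measurable_diff borel_measurable_add)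
  have "(\<lambda>n. \<integral>x. ?E (of_real (r n) * ?e x) \<partial>uniform_01) \<longlonglongrightarrow> (\<integral>x. ?E (?e x) \<partial>uniform_01)"
  proof (rule integral_dominated_convergence[where w = "\<lambda>_. 1"])
    show "AE x in uniform_01. (\<lambda>n. ?E (of_real (r n) * ?e x)) \<longlonglongrightarrow> ?E (?e x)"
      using bd by eventually_elim (intro tendsto_exp tendsto_mult_left inner; blast)
    show "AE x in uniform_01. norm (?E (of_real (r n) * ?e x)) \<le> 1" for n
      using r[of n] by (intro AE_I2 bound) (simp add: norm_mult)
    show "(\<lambda>x. ?E (?e x)) \<in> borel_measurable uniform_01"
      unfolding disc_cauchy_def by measurable
  qed auto
  moreover have "(\<integral>x. ?E (of_real (r n) * ?e x) \<partial>uniform_01) = exp (- of_real t)" for n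
  proof -
    have "(\<integral>x. ?E (of_real (r n) * ?e x) \<partial>uniform_01) = ?E 0"
      by (rule mean_value_circle[OF hol r])
    also have "\<dots> = exp (\<i> * of_real t * \<i>)"
      by (simp only: disc_cauchy_upper_half_plane(2)[OF assms(1-3)])
    also have "\<i> * of_real t * \<i> = - of_real t"
      by (simp add: mult.commute mult.left_commute)
    finally show ?thesis .
  qed
  ultimately have "(\<lambda>n. exp (- of_real t)) \<longlonglongrightarrow> (\<integral>x. ?E (?e x) \<partial>uniform_01)"
    by simp
  then show ?thesis
    using LIMSEQ_unique tendsto_const by blast
qed

section \<open>The Laplace transform of the squared field norm under the Gaussian\<close>

text \<open>
  The square of the direction of \<open>\<beta> + \<i> \<alpha>\<close>, that is \<open>exp(2 \<i> \<phi>)\<close> when \<open>\<beta> + \<i> \<alpha> = r exp(\<i> \<phi>)\<close>. The value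
  \<open>1\<close> at the origin keeps it unimodular everywhere.
\<close>

definition phase :: "real \<Rightarrow> real \<Rightarrow> complex" where
  "phase \<alpha> \<beta> = (if \<alpha> = 0 \<and> \<beta> = 0 then 1 else Complex \<beta> \<alpha> / Complex \<beta> (- \<alpha>))"

lemma norm_phase: "norm (phase \<alpha> \<beta>) = 1"
  by (auto simp: phase_def norm_divide complex_norm sum_power2_eq_zero_iff)

lemma phase_measurable [measurable (raw)]:
  assumes [measurable]: "f \<in> borel_measurable M" "g \<in> borel_measurable M"
  shows "(\<lambda>x. phase (f x) (g x)) \<in> borel_measurable M"
  unfolding phase_def Complex_eq by measurable

text \<open>
  The last identity says that \<open>tan(\<phi> + \<theta>)\<close> is the ratio of the rotated coordinates of \<open>(\<alpha>, \<beta>)\<close>. All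
  three claims follow by taking the common factor
  \<open>k = exp(\<i> \<theta>) / (\<beta> - \<i> \<alpha>)\<close> out of \<open>1 \<plusminus> phase \<alpha> \<beta> * e\<close>.
\<close>

lemma phase_rotation:
  fixes \<alpha> \<beta> c s :: real
  defines "e \<equiv> (Complex c s)\<^sup>2"
  assumes cs: "c\<^sup>2 + s\<^sup>2 = 1" and nz: "c * \<beta> - s * \<alpha> \<noteq> 0"
  shows "1 + phase \<alpha> \<beta> * e \<noteq> 0"
    and "norm (1 + phase \<alpha> \<beta> * e) = 2 * \<bar>c * \<beta> - s * \<alpha>\<bar> / sqrt (\<alpha>\<^sup>2 + \<beta>\<^sup>2)"
    and "\<i> * (1 - phase \<alpha> \<beta> * e) / (1 + phase \<alpha> \<beta> * e) = of_real ((c * \<alpha> + s * \<beta>) / (c * \<beta> - s * \<alpha>))"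
proof -
  define k where "k = Complex c s / Complex \<beta> (- \<alpha>)"
  have nd: "\<not> (\<alpha> = 0 \<and> \<beta> = 0)" using nz by auto
  then have d: "Complex \<beta> (- \<alpha>) \<noteq> 0" by (auto simp: complex_eq_iff)
  have cs1: "Complex c s * Complex c (- s) = 1"
    using cs by (simp add: complex_eq_iff power2_eq_square)
  have k0: "k \<noteq> 0" using cs1 d by (auto simp: k_def)
  have "Complex \<beta> (- \<alpha>) = Complex c s * (Complex c (- s) * Complex \<beta> (- \<alpha>))"
    by (simp only: mult.assoc[symmetric] cs1 mult_1)
  then have one: "1 = k * (Complex c (- s) * Complex \<beta> (- \<alpha>))"
    using d by (simp add: k_def field_simps)
  have ph: "phase \<alpha> \<beta> * e = k * (Complex c s * Complex \<beta> \<alpha>)"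
  proof -
    have "phase \<alpha> \<beta> = Complex \<beta> \<alpha> / Complex \<beta> (- \<alpha>)" using nd by (auto simp: phase_def)
    then show ?thesis by (simp only: k_def e_def power2_eq_square times_divide_eq_left times_divide_eq_right mult_ac)
  qed
  have "Complex c (- s) * Complex \<beta> (- \<alpha>) + Complex c s * Complex \<beta> \<alpha> = of_real (2 * (c * \<beta> - s * \<alpha>))"
    by (simp add: complex_eq_iff)
  then have p: "1 + phase \<alpha> \<beta> * e = k * of_real (2 * (c * \<beta> - s * \<alpha>))"
    unfolding ph by (subst one) (simp only: distrib_left[symmetric])
  have "Complex c (- s) * Complex \<beta> (- \<alpha>) - Complex c s * Complex \<beta> \<alpha> = - 2 * \<i> * of_real (c * \<alpha> + s * \<beta>)"
    by (simp add: complex_eq_iff)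
  then have m: "1 - phase \<alpha> \<beta> * e = k * (- 2 * \<i> * of_real (c * \<alpha> + s * \<beta>))"
    unfolding ph by (subst one) (simp only: right_diff_distrib[symmetric])
  have r: "(of_real (c * \<beta> - s * \<alpha>) :: complex) \<noteq> 0"
    using nz by (simp only: of_real_eq_0_iff) simp
  show "1 + phase \<alpha> \<beta> * e \<noteq> 0"
    unfolding p using k0 nz by (simp only: mult_eq_0_iff of_real_eq_0_iff) simp
  have "norm k = 1 / sqrt (\<alpha>\<^sup>2 + \<beta>\<^sup>2)"
    using cs by (simp add: k_def norm_divide complex_norm add.commute)
  then show "norm (1 + phase \<alpha> \<beta> * e) = 2 * \<bar>c * \<beta> - s * \<alpha>\<bar> / sqrt (\<alpha>\<^sup>2 + \<beta>\<^sup>2)"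
    unfolding p norm_mult norm_of_real abs_mult by simp
  have "\<i> * (1 - phase \<alpha> \<beta> * e) / (1 + phase \<alpha> \<beta> * e)
      = (k * 2 * of_real (c * \<alpha> + s * \<beta>)) / (k * 2 * of_real (c * \<beta> - s * \<alpha>))"
    unfolding p m by (simp add: mult_ac)
  also have "\<dots> = of_real (c * \<alpha> + s * \<beta>) / of_real (c * \<beta> - s * \<alpha>)"
    by (rule mult_divide_mult_cancel_left) (use k0 in simp)
  finally show "\<i> * (1 - phase \<alpha> \<beta> * e) / (1 + phase \<alpha> \<beta> * e) = of_real ((c * \<alpha> + s * \<beta>) / (c * \<beta> - s * \<alpha>))"
    by simp
qed

lemma inv_energy_scale:
  fixes \<mu> :: "(real ^ 'n) measure"
  assumes [measurable_cong]: "sets \<mu> = sets borel" and c: "0 < c"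
  shows "inv_energy \<mu> (c *\<^sub>R y) < \<infinity> \<longleftrightarrow> inv_energy \<mu> y < \<infinity>"
proof -
  have "1 / ennreal \<bar>a \<bullet> c *\<^sub>R y\<bar> = ennreal (1 / c) * (1 / ennreal \<bar>a \<bullet> y\<bar>)" for a
  proof (cases "a \<bullet> y = 0")
    case False
    then have "1 / ennreal \<bar>a \<bullet> y\<bar> = ennreal (1 / \<bar>a \<bullet> y\<bar>)"
      by (subst divide_ennreal[symmetric]) auto
    moreover have "1 / ennreal \<bar>a \<bullet> c *\<^sub>R y\<bar> = ennreal (1 / \<bar>a \<bullet> c *\<^sub>R y\<bar>)"
      using False c by (subst divide_ennreal[symmetric]) auto
    ultimately show ?thesis using c by (simp add: ennreal_mult[symmetric] abs_mult)
  qed (use c in \<open>simp add: ennreal_mult_top\<close>)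
  then have "inv_energy \<mu> (c *\<^sub>R y) = (\<integral>\<^sup>+a. ennreal (1 / c) * (1 / ennreal \<bar>a \<bullet> y\<bar>) \<partial>\<mu>)"
    by (simp add: inv_energy_def)
  also have "\<dots> = ennreal (1 / c) * inv_energy \<mu> y"
    unfolding inv_energy_def by (rule nn_integral_cmult) measurable
  finally show ?thesis using c by (auto simp: ennreal_mult_less_top)
qed

locale sphere_measure = prob_space \<mu> for \<mu> :: "(real ^ 'n) measure" +
  assumes sets_\<mu> [simp, measurable_cong]: "sets \<mu> = sets borel"
    and AE_norm: "AE a in \<mu>. norm a = 1"
begin

lemma space_\<mu> [simp]: "space \<mu> = UNIV"
  using sets_eq_imp_space_eq[OF sets_\<mu>] by simp

lemma measurable_inv_energy [measurable]: "inv_energy \<mu> \<in> borel_measurable borel"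
  unfolding inv_energy_def[abs_def] by measurable

lemma measurable_g_field [measurable]: "g_field \<mu> \<in> borel_measurable borel"
  unfolding g_field_def[abs_def] by measurable

lemma inv_energy_finiteD:
  assumes "inv_energy \<mu> y < \<infinity>"
  shows "AE a in \<mu>. a \<bullet> y \<noteq> 0"
    and "integrable \<mu> (\<lambda>a. 1 / \<bar>a \<bullet> y\<bar>)"
    and "integrable \<mu> (\<lambda>a. (1 / (a \<bullet> y)) *\<^sub>R a)"
proof -
  have "AE a in \<mu>. 1 / ennreal \<bar>a \<bullet> y\<bar> \<noteq> \<infinity>"
    using assms unfolding inv_energy_def by (intro nn_integral_noteq_infinite) auto
  then show nz: "AE a in \<mu>. a \<bullet> y \<noteq> 0"
    by eventually_elim auto
  have "(\<integral>\<^sup>+a. ennreal (1 / \<bar>a \<bullet> y\<bar>) \<partial>\<mu>) = inv_energy \<mu> y"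
    unfolding inv_energy_def
    by (rule nn_integral_cong_AE, use nz in eventually_elim) (simp flip: divide_ennreal)
  then show i: "integrable \<mu> (\<lambda>a. 1 / \<bar>a \<bullet> y\<bar>)"
    using assms by (intro integrableI_nonneg) auto
  show "integrable \<mu> (\<lambda>a. (1 / (a \<bullet> y)) *\<^sub>R a)"
    by (rule Bochner_Integration.integrable_bound[OF i]) (use AE_norm in \<open>auto elim!: eventually_mono\<close>)
qed

lemma inner_g_field:
  assumes "inv_energy \<mu> y < \<infinity>"
  shows "x \<bullet> g_field \<mu> y = (\<integral>a. (a \<bullet> x) / (a \<bullet> y) \<partial>\<mu>)"
  unfolding g_field_def
  by (subst integral_inner_right[symmetric]) (use inv_energy_finiteD(3)[OF assms] in \<open>auto simp: inner_commute\<close>)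

lemma inner_self_g_field:
  assumes "inv_energy \<mu> y < \<infinity>"
  shows "y \<bullet> g_field \<mu> y = 1"
proof -
  have "(\<integral>a. (a \<bullet> y) / (a \<bullet> y) \<partial>\<mu>) = (\<integral>a. 1 \<partial>\<mu>)"
    using inv_energy_finiteD(1)[OF assms] by (intro integral_cong_AE) auto
  then show ?thesis using prob_space by (simp add: inner_g_field[OF assms])
qed

lemma g_field_scale: "c \<noteq> 0 \<Longrightarrow> g_field \<mu> (c *\<^sub>R y) = (1 / c) *\<^sub>R g_field \<mu> y"
  unfolding g_field_def by (subst integral_scaleR_right[symmetric]) simp

end

text \<open>
  Isolates what the law of the field norm requires of the measure; mixtures of small caps enter only
  through \<open>inv_energy_mixture_finite\<close>.
\<close>

locale finite_energy_measure = sphere_measure \<mu> for \<mu> :: "(real ^ 'n) measure" +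
  assumes finite_energy: "AE u in sphere_uniform. inv_energy \<mu> u < \<infinity>"
begin

lemma AE_lborel_inv_energy: "AE y in lborel. inv_energy \<mu> y < \<infinity>"
  using finite_energy by (subst AE_lborel_cone_iff_AE_sphere_uniform) (auto simp: inv_energy_scale[OF sets_\<mu>, simplified])

lemma AE_gauss_inv_energy: "AE y in gauss. inv_energy \<mu> y < \<infinity>"
  unfolding gauss_eq using AE_lborel_inv_energy by (subst AE_density) auto

text \<open>
  Along the orbit of one pair \<open>(x, y)\<close> the variable \<open>X \<bullet> g_field \<mu> Y\<close> runs through the boundary values
  of \<open>disc_cauchy \<mu> q\<close>, where \<open>q a\<close> is the phase of \<open>(a \<bullet> x, a \<bullet> y)\<close>. The rotation angle \<open>\<pi> r\<close> with
  \<open>0 \<le> r \<le> 1\<close> makes \<open>exp(2 \<i> \<theta>)\<close> go round the circle once.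
\<close>

lemma cauchy_along_rotations:
  fixes x y :: "real ^ 'n"
  assumes fin: "AE r in uniform_01. inv_energy \<mu> (snd (rot (cos (pi * r)) (sin (pi * r)) (x, y))) < \<infinity>"
    and t: "0 \<le> t"
  shows "(\<integral>r. iexp (t * (fst (rot (cos (pi * r)) (sin (pi * r)) (x, y))
       \<bullet> g_field \<mu> (snd (rot (cos (pi * r)) (sin (pi * r)) (x, y))))) \<partial>uniform_01) = exp (- of_real t)"
proof -
  define q where "q a = phase (a \<bullet> x) (a \<bullet> y)" for a
  define X where "X r = cos (pi * r) *\<^sub>R x + sin (pi * r) *\<^sub>R y" for r
  define Y where "Y r = cos (pi * r) *\<^sub>R y - sin (pi * r) *\<^sub>R x" for r
  let ?e = "\<lambda>r::real. exp (2 * of_real pi * \<i> * of_real r) :: complex"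
  have q_meas [measurable]: "q \<in> borel_measurable \<mu>" unfolding q_def by measurable
  have q1: "norm (q a) = 1" for a by (simp add: q_def norm_phase)
  have e: "?e r = (Complex (cos (pi * r)) (sin (pi * r)))\<^sup>2" for r
  proof -
    have "?e r = cis (pi * r) ^ 2"
      by (simp add: cis_conv_exp flip: exp_of_nat_mult) (simp add: mult_ac)
    then show ?thesis by (simp add: cis.ctr)
  qed
  have aX: "a \<bullet> X r = cos (pi * r) * (a \<bullet> x) + sin (pi * r) * (a \<bullet> y)" for a r
    by (simp add: X_def inner_add_right)
  have aY: "a \<bullet> Y r = cos (pi * r) * (a \<bullet> y) - sin (pi * r) * (a \<bullet> x)" for a r
    by (simp add: Y_def inner_diff_right)
  have P: "1 + q a * ?e r \<noteq> 0" "1 / norm (1 + q a * ?e r) = sqrt ((a \<bullet> x)\<^sup>2 + (a \<bullet> y)\<^sup>2) / 2 * (1 / \<bar>a \<bullet> Y r\<bar>)"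
    "\<i> * (1 - q a * ?e r) / (1 + q a * ?e r) = of_real ((a \<bullet> X r) / (a \<bullet> Y r))"
    if "a \<bullet> Y r \<noteq> 0" for a r
    using phase_rotation[of "cos (pi * r)" "sin (pi * r)" "a \<bullet> y" "a \<bullet> x"] that
    by (simp_all add: e q_def aX aY)
  have disc: "disc_cauchy \<mu> q (?e r) = of_real (X r \<bullet> g_field \<mu> (Y r))"
    if fin: "inv_energy \<mu> (Y r) < \<infinity>" for r
  proof -
    have "disc_cauchy \<mu> q (?e r) = (\<integral>a. complex_of_real ((a \<bullet> X r) / (a \<bullet> Y r)) \<partial>\<mu>)"
      unfolding disc_cauchy_def
      by (rule integral_cong_AE) (use inv_energy_finiteD(1)[OF fin] in \<open>auto simp: P(3) elim!: eventually_mono\<close>)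
    also have "\<dots> = of_real (X r \<bullet> g_field \<mu> (Y r))"
      by (simp only: inner_g_field[OF fin] integral_complex_of_real)
    finally show ?thesis .
  qed
  have "(\<integral>r. exp (\<i> * of_real t * disc_cauchy \<mu> q (?e r)) \<partial>uniform_01) = exp (- of_real t)"
  proof (rule boundary_cauchy[OF prob_space_axioms q_meas q1 _ t])
    show "AE r in uniform_01. (AE a in \<mu>. 1 + q a * ?e r \<noteq> 0) \<and>
       integrable \<mu> (\<lambda>a. 1 / norm (1 + q a * ?e r))"
      using fin
    proof eventually_elim
      case (elim r)
      then have fin: "inv_energy \<mu> (Y r) < \<infinity>" by (simp add: rot_def Y_def)
      note nz = inv_energy_finiteD(1)[OF fin]
      have "integrable \<mu> (\<lambda>a. 1 / norm (1 + q a * ?e r))"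
      proof (rule Bochner_Integration.integrable_bound)
        show "integrable \<mu> (\<lambda>a. (norm x + norm y) / 2 * (1 / \<bar>a \<bullet> Y r\<bar>))"
          by (rule integrable_mult_right[OF inv_energy_finiteD(2)[OF fin]])
        show "AE a in \<mu>. norm (1 / norm (1 + q a * ?e r)) \<le> norm ((norm x + norm y) / 2 * (1 / \<bar>a \<bullet> Y r\<bar>))"
          using nz AE_norm
        proof eventually_elim
          case (elim a)
          have "sqrt ((a \<bullet> x)\<^sup>2 + (a \<bullet> y)\<^sup>2) \<le> \<bar>a \<bullet> x\<bar> + \<bar>a \<bullet> y\<bar>"
            by (rule sqrt_sum_squares_le_sum_abs)
          also have "\<dots> \<le> norm x + norm y"
            using Cauchy_Schwarz_ineq2[of a x] Cauchy_Schwarz_ineq2[of a y] elim by simp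
          finally have "sqrt ((a \<bullet> x)\<^sup>2 + (a \<bullet> y)\<^sup>2) / 2 * (1 / \<bar>a \<bullet> Y r\<bar>) \<le> (norm x + norm y) / 2 * (1 / \<bar>a \<bullet> Y r\<bar>)"
            by (intro mult_right_mono) auto
          moreover have "0 \<le> 1 / norm (1 + q a * ?e r)" by simp
          ultimately show ?case using P(2)[of a r] elim by (simp add: abs_mult)
        qed
      qed measurable
      moreover have "AE a in \<mu>. 1 + q a * ?e r \<noteq> 0"
        using nz by eventually_elim (rule P(1))
      ultimately show ?case by blast
    qed
  qed
  moreover have "(\<integral>r. exp (\<i> * of_real t * disc_cauchy \<mu> q (?e r)) \<partial>uniform_01)
    = (\<integral>r. iexp (t * (X r \<bullet> g_field \<mu> (Y r))) \<partial>uniform_01)"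
  proof (rule integral_cong_AE)
    show "AE r in uniform_01. exp (\<i> * of_real t * disc_cauchy \<mu> q (?e r)) = iexp (t * (X r \<bullet> g_field \<mu> (Y r)))"
      using fin
    proof eventually_elim
      case (elim r)
      then have "inv_energy \<mu> (Y r) < \<infinity>" by (simp add: rot_def Y_def)
      then show ?case by (simp only: disc) (simp add: mult.assoc)
    qed
    show "(\<lambda>r. exp (\<i> * of_real t * disc_cauchy \<mu> q (?e r))) \<in> borel_measurable uniform_01"
      unfolding disc_cauchy_def by measurable
    show "(\<lambda>r. iexp (t * (X r \<bullet> g_field \<mu> (Y r)))) \<in> borel_measurable uniform_01"
      unfolding X_def Y_def by measurable
  qed
  ultimately show ?thesis by (simp add: rot_def X_def Y_def)
qed

text \<open>
  The average of \<open>exp(\<i> t X \<bullet> g(Y))\<close> is computed in two ways. Averaging over rotations of the pair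
  first gives \<open>exp(- t)\<close>; integrating over \<open>X\<close> first gives the left-hand side, because
  \<open>X \<bullet> v\<close> is normal with variance \<open>\<parallel>v\<parallel>\<^sup>2\<close>.
\<close>

lemma laplace_norm_g_field:
  assumes t: "0 \<le> t"
  shows "(\<integral>y. exp (- t\<^sup>2 * (norm (g_field \<mu> y))\<^sup>2 / 2) \<partial>gauss) = exp (- t)"
proof -
  let ?g = "gauss :: (real ^ 'n) measure" and ?B = "(borel :: (real ^ 'n) measure) \<Otimes>\<^sub>M borel"
  let ?u = uniform_01
  interpret g: prob_space ?g by (rule prob_space_gauss)
  interpret u: prob_space ?u by (rule prob_space_uniform_01)
  interpret gg: pair_prob_space ?g ?g ..
  interpret ug: pair_prob_space ?u "?g \<Otimes>\<^sub>M ?g" ..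
  have sN [measurable_cong, simp]: "sets (?g \<Otimes>\<^sub>M ?g) = sets ?B"
    by (intro sets_pair_measure_cong) auto
  define R where "R r z = rot (cos (pi * r)) (sin (pi * r)) z" for r and z :: "(real ^ 'n) \<times> (real ^ 'n)"
  define \<Psi> where "\<Psi> z = iexp (t * (fst z \<bullet> g_field \<mu> (snd z)))" for z
  have [measurable]: "\<Psi> \<in> borel_measurable ?B" unfolding \<Psi>_def by measurable
  have [measurable]: "(\<lambda>p. R (fst p) (snd p)) \<in> measurable (borel \<Otimes>\<^sub>M ?B) ?B"
    unfolding R_def rot_def by measurable
  have [measurable]: "(\<lambda>p. R (snd p) (fst p)) \<in> measurable (?B \<Otimes>\<^sub>M borel) ?B"
    unfolding R_def rot_def by measurable
  have R1 [measurable]: "R r \<in> measurable ?B ?B" for r unfolding R_def by measurable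
  have n\<Psi>: "norm (\<Psi> z) = 1" for z by (simp add: \<Psi>_def)
  \<comment> \<open>For each angle the rotated pair avoids the set of infinite energy almost surely. Fubini
    turns this into a statement about almost every angle for almost every pair.\<close>
  have inv: "distr (?g \<Otimes>\<^sub>M ?g) ?B (R r) = ?g \<Otimes>\<^sub>M ?g" for r
    unfolding R_def by (rule gauss_pair_rot) simp
  have "Measurable.pred (?g \<Otimes>\<^sub>M ?g) (\<lambda>z. inv_energy \<mu> (snd z) < \<infinity>)"
    by measurable
  then have "AE z in ?g \<Otimes>\<^sub>M ?g. inv_energy \<mu> (snd z) < \<infinity>"
    using AE_gauss_inv_energy by (intro gg.AE_pair_measure) (simp_all only: pred_def snd_conv AE_const, simp)
  then have "AE z in distr (?g \<Otimes>\<^sub>M ?g) ?B (R r). inv_energy \<mu> (snd z) < \<infinity>" for r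
    by (simp only: inv)
  then have "AE z in ?g \<Otimes>\<^sub>M ?g. inv_energy \<mu> (snd (R r z)) < \<infinity>" for r
    by (subst (asm) AE_distr_iff) auto
  then have "AE r in ?u. AE z in ?g \<Otimes>\<^sub>M ?g. inv_energy \<mu> (snd (R r z)) < \<infinity>"
    by simp
  moreover have "Measurable.pred (?u \<Otimes>\<^sub>M (?g \<Otimes>\<^sub>M ?g)) (\<lambda>p. inv_energy \<mu> (snd (R (fst p) (snd p))) < \<infinity>)"
    by measurable
  ultimately have AE: "AE z in ?g \<Otimes>\<^sub>M ?g. AE r in ?u. inv_energy \<mu> (snd (R r z)) < \<infinity>"
    by (subst (asm) ug.AE_commute) (simp_all only: pred_def)
  have int: "integrable (?u \<Otimes>\<^sub>M (?g \<Otimes>\<^sub>M ?g)) (\<lambda>(r, z). \<Psi> (R r z))"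
    by (rule ug.P.integrable_const_bound[where B = 1]) (auto simp: n\<Psi> split_beta)
  have "(\<integral>z. \<Psi> z \<partial>(?g \<Otimes>\<^sub>M ?g)) = (\<integral>z. \<Psi> (R r z) \<partial>(?g \<Otimes>\<^sub>M ?g))" for r
    by (subst inv[of r, symmetric], subst integral_distr) auto
  then have "(\<integral>z. \<Psi> z \<partial>(?g \<Otimes>\<^sub>M ?g)) = (\<integral>r. \<integral>z. \<Psi> (R r z) \<partial>(?g \<Otimes>\<^sub>M ?g) \<partial>?u)"
    using u.prob_space by (simp flip: \<open>\<And>r. _ = (\<integral>z. \<Psi> (R r z) \<partial>(?g \<Otimes>\<^sub>M ?g))\<close>)
  also have "\<dots> = (\<integral>z. \<integral>r. \<Psi> (R r z) \<partial>?u \<partial>(?g \<Otimes>\<^sub>M ?g))"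
    by (rule ug.Fubini_integral[OF int, symmetric])
  also have "\<dots> = (\<integral>z. exp (- of_real t) \<partial>(?g \<Otimes>\<^sub>M ?g))"
  proof (rule integral_cong_AE)
    show "AE z in ?g \<Otimes>\<^sub>M ?g. (\<integral>r. \<Psi> (R r z) \<partial>?u) = exp (- of_real t)"
      using AE
    proof eventually_elim
      case (elim z)
      then show ?case
        using cauchy_along_rotations[of "fst z" "snd z" t] t by (simp add: \<Psi>_def R_def)
    qed
    show "(\<lambda>z. \<integral>r. \<Psi> (R r z) \<partial>?u) \<in> borel_measurable (?g \<Otimes>\<^sub>M ?g)" by measurable
  qed simp
  also have "\<dots> = exp (- of_real t)"
    using gg.P.prob_space by simp
  finally have 1: "(\<integral>z. \<Psi> z \<partial>(?g \<Otimes>\<^sub>M ?g)) = exp (- of_real t)" .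
  have "(\<integral>z. \<Psi> z \<partial>(?g \<Otimes>\<^sub>M ?g)) = (\<integral>y. \<integral>x. \<Psi> (x, y) \<partial>?g \<partial>?g)"
    by (subst gg.integral_snd) (auto intro!: gg.P.integrable_const_bound[where B = 1] simp: n\<Psi>)
  also have "\<dots> = (\<integral>y. complex_of_real (exp (- t\<^sup>2 * (norm (g_field \<mu> y))\<^sup>2 / 2)) \<partial>?g)"
    using gauss_char[of "t *\<^sub>R g_field \<mu> _"]
    by (simp add: \<Psi>_def inner_commute power_mult_distrib)
  also have "\<dots> = of_real (\<integral>y. exp (- t\<^sup>2 * (norm (g_field \<mu> y))\<^sup>2 / 2) \<partial>?g)"
    by (rule integral_complex_of_real)
  finally have "complex_of_real (\<integral>y. exp (- t\<^sup>2 * (norm (g_field \<mu> y))\<^sup>2 / 2) \<partial>?g) = of_real (exp (- t))"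
    using 1 by (simp flip: exp_of_real)
  then show ?thesis by (simp only: of_real_eq_iff)
qed

end

section \<open>Moments on the sphere\<close>

context finite_energy_measure
begin

lemma one_le_norm_g_field:
  assumes "inv_energy \<mu> u < \<infinity>" "norm u = 1"
  shows "1 \<le> norm (g_field \<mu> u)"
  using Cauchy_Schwarz_ineq2[of u "g_field \<mu> u"] assms by (simp add: inner_self_g_field)

text \<open>
  Integrate \<open>laplace_norm_g_field\<close> against \<open>t\<^bsup>2k+1\<^esup> dt\<close> over the half line and exchange the integrals:
  the integral over \<open>t\<close> of \<open>t\<^bsup>2k+1\<^esup> exp(- t\<^sup>2 q / 2)\<close> is \<open>2\<^sup>k k! / q\<^bsup>k+1\<^esup>\<close>, and that of
  \<open>t\<^bsup>2k+1\<^esup> exp(- t)\<close> is \<open>(2k+1)!\<close>.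
\<close>

lemma gauss_moment_g_field:
  "(\<integral>\<^sup>+y. ennreal (1 / (norm (g_field \<mu> y)) ^ (2 * Suc k)) \<partial>gauss) = ennreal (fact (2 * k + 1) / (2 ^ k * fact k))"
proof -
  interpret g: prob_space "gauss :: (real ^ 'n) measure" by (rule prob_space_gauss)
  interpret lg: pair_sigma_finite "gauss :: (real ^ 'n) measure" "lborel :: real measure" ..
  let ?f = "\<lambda>y t. ennreal (t ^ (2 * k + 1) * exp (- (t\<^sup>2 * (norm (g_field \<mu> y))\<^sup>2 / 2))) * indicator {0..} t"
  have inner: "(\<integral>\<^sup>+t. ?f y t \<partial>lborel) = ennreal (2 ^ k * fact k) * ennreal (1 / (norm (g_field \<mu> y)) ^ (2 * Suc k))"
    if "inv_energy \<mu> y < \<infinity>" for y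
  proof -
    have "g_field \<mu> y \<noteq> 0" using inner_self_g_field[OF that] by auto
    then have "(\<integral>\<^sup>+t. ?f y t \<partial>lborel) = ennreal (half_moment (2 * k + 1) / sqrt ((norm (g_field \<mu> y))\<^sup>2) ^ (2 * k + 1 + 1))"
      by (intro nn_integral_gauss_half_line) simp
    also have "\<dots> = ennreal (2 ^ k * fact k * (1 / (norm (g_field \<mu> y)) ^ (2 * Suc k)))"
      unfolding half_moment_odd by simp
    also have "\<dots> = ennreal (2 ^ k * fact k) * ennreal (1 / (norm (g_field \<mu> y)) ^ (2 * Suc k))"
      by (rule ennreal_mult) auto
    finally show ?thesis .
  qed
  have outer: "(\<integral>\<^sup>+y. ?f y t \<partial>gauss) = ennreal (t ^ (2 * k + 1) * exp (- t)) * indicator {0..} t" for t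
  proof (cases "0 \<le> t")
    case True
    have "(\<integral>\<^sup>+y. ?f y t \<partial>gauss) = (\<integral>\<^sup>+y. ennreal (t ^ (2 * k + 1)) * ennreal (exp (- t\<^sup>2 * (norm (g_field \<mu> y))\<^sup>2 / 2)) \<partial>gauss)"
      using True by (simp add: ennreal_mult)
    also have "\<dots> = ennreal (t ^ (2 * k + 1)) * (\<integral>\<^sup>+y. ennreal (exp (- t\<^sup>2 * (norm (g_field \<mu> y))\<^sup>2 / 2)) \<partial>gauss)"
      by (rule nn_integral_cmult) measurable
    also have "(\<integral>\<^sup>+y. ennreal (exp (- t\<^sup>2 * (norm (g_field \<mu> y))\<^sup>2 / 2)) \<partial>gauss) = ennreal (exp (- t))"
      using laplace_norm_g_field[OF True]
      by (subst nn_integral_eq_integral) (auto intro!: g.integrable_const_bound[where B = 1])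
    finally show ?thesis using True by (simp add: ennreal_mult)
  qed simp
  have "ennreal (2 ^ k * fact k) * (\<integral>\<^sup>+y. ennreal (1 / (norm (g_field \<mu> y)) ^ (2 * Suc k)) \<partial>gauss)
      = (\<integral>\<^sup>+y. ennreal (2 ^ k * fact k) * ennreal (1 / (norm (g_field \<mu> y)) ^ (2 * Suc k)) \<partial>gauss)"
    by (rule nn_integral_cmult[symmetric]) measurable
  also have "\<dots> = (\<integral>\<^sup>+y. \<integral>\<^sup>+t. ?f y t \<partial>lborel \<partial>gauss)"
    by (rule nn_integral_cong_AE) (use AE_gauss_inv_energy in \<open>eventually_elim; simp only: inner\<close>)
  also have "\<dots> = (\<integral>\<^sup>+t. \<integral>\<^sup>+y. ?f y t \<partial>gauss \<partial>lborel)"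
    by (rule lg.Fubini'[symmetric]) measurable
  also have "\<dots> = ennreal (fact (2 * k + 1))"
    unfolding outer nn_intergal_power_times_exp_Ici by (simp del: fact_Suc)
  finally have eq: "ennreal (2 ^ k * fact k) * (\<integral>\<^sup>+y. ennreal (1 / (norm (g_field \<mu> y)) ^ (2 * Suc k)) \<partial>gauss)
      = ennreal (fact (2 * k + 1))" .
  have "(\<integral>\<^sup>+y. ennreal (1 / (norm (g_field \<mu> y)) ^ (2 * Suc k)) \<partial>gauss)
      = ennreal (1 / (2 ^ k * fact k)) * (ennreal (2 ^ k * fact k) * (\<integral>\<^sup>+y. ennreal (1 / (norm (g_field \<mu> y)) ^ (2 * Suc k)) \<partial>gauss))"
    by (simp add: mult.assoc[symmetric] ennreal_mult[symmetric] del: power_Suc)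
  also have "\<dots> = ennreal (fact (2 * k + 1) / (2 ^ k * fact k))"
    unfolding eq by (simp add: ennreal_mult[symmetric] del: fact_Suc)
  finally show ?thesis .
qed

text \<open>
  The Gaussian moment is the product of the sphere moment and of
  \<open>E \<parallel>Y\<parallel>\<^bsup>2k\<^esup> = 2\<^sup>k pochhammer (n/2) k\<close>, since \<open>(\<parallel>y\<parallel> \<parallel>g(y)\<parallel>)\<^bsup>-2k\<^esup>\<close> is homogeneous of degree zero.
  The Gaussian moment itself is \<open>2\<^sup>k pochhammer (1/2) k\<close>.
\<close>

lemma sphere_moment_g_field:
  "(\<integral>u. (1 / (norm (g_field \<mu> u))\<^sup>2) ^ k \<partial>sphere_uniform) = pochhammer (1 / 2) k / pochhammer (real CARD('n) / 2) k"
proof (cases k)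
  case 0
  interpret su: prob_space "sphere_uniform :: (real ^ 'n) measure" by (rule prob_space_sphere_uniform)
  show ?thesis using 0 su.prob_space by simp
next
  case (Suc j)
  let ?n = "CARD('n)"
  \<comment> \<open>The value 0 where the energy is infinite keeps \<open>G\<close> homogeneous and bounded by
    1.\<close>
  define G where "G u = (if inv_energy \<mu> u < \<infinity> \<and> u \<noteq> 0 then ennreal ((1 / (norm u * norm (g_field \<mu> u))) ^ (2 * k)) else 0)" for u
  have [measurable]: "G \<in> borel_measurable borel" unfolding G_def by measurable
  have deg0: "G (c *\<^sub>R x) = G x" if "0 < c" for c x
    using that inv_energy_scale[OF sets_\<mu>, of c x] by (auto simp: G_def g_field_scale power_mult_distrib power_divide)
  have le1: "G x \<le> 1" for x
  proof (cases "inv_energy \<mu> x < \<infinity> \<and> x \<noteq> 0")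
    case True
    then have "1 \<le> norm x * norm (g_field \<mu> x)"
      using Cauchy_Schwarz_ineq2[of x "g_field \<mu> x"] by (simp add: inner_self_g_field)
    then have "1 / (norm x * norm (g_field \<mu> x)) \<le> 1" by (simp add: divide_le_eq)
    then have "(1 / (norm x * norm (g_field \<mu> x))) ^ (2 * k) \<le> 1" by (intro power_le_one) auto
    then show ?thesis using True by (simp add: G_def)
  qed (auto simp: G_def)
  define C where "C = (\<integral>\<^sup>+x. G x * indicator (ball 0 1) x \<partial>(lborel :: (real ^ 'n) measure))"
  define vol where "vol = emeasure lborel (ball (0 :: real ^ 'n) 1)"
  define c where "c = (1 / sqrt (2 * pi)) ^ ?n"
  have c: "0 < c" by (simp add: c_def)
  have radial: "(\<integral>\<^sup>+x. ennreal (norm x ^ m) * F x \<partial>gauss)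
      = ennreal (c * ?n * half_moment (m + (?n - 1))) * (\<integral>\<^sup>+x. F x * indicator (ball 0 1) x \<partial>lborel)"
    if [measurable]: "F \<in> borel_measurable borel" and d: "\<And>c x. 0 < c \<Longrightarrow> F (c *\<^sub>R x) = F x" and l: "\<And>x. F x \<le> 1"
    for F :: "real ^ 'n \<Rightarrow> ennreal" and m
  proof -
    have "(\<integral>\<^sup>+x. ennreal (norm x ^ m) * F x \<partial>gauss)
        = (\<integral>\<^sup>+x. ennreal (c * exp (- (norm x)\<^sup>2 / 2) * norm x ^ m) * F x \<partial>lborel)"
      unfolding gauss_eq using c
      by (subst nn_integral_density) (auto simp: c_def ennreal_mult mult.assoc)
    also have "\<dots> = (\<integral>\<^sup>+x. F x * indicator (ball 0 1) x \<partial>lborel)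
       * (\<integral>\<^sup>+r. ennreal (c * exp (- r\<^sup>2 / 2) * r ^ m) * (ennreal (DIM(real ^ 'n) * r ^ (DIM(real ^ 'n) - 1)) * indicator {0..} r) \<partial>lborel)"
      by (rule nn_integral_polar[OF that(1) _ d l]) auto
    also have "(\<integral>\<^sup>+r. ennreal (c * exp (- r\<^sup>2 / 2) * r ^ m) * (ennreal (DIM(real ^ 'n) * r ^ (DIM(real ^ 'n) - 1)) * indicator {0..} r) \<partial>lborel)
        = (\<integral>\<^sup>+r. ennreal (c * ?n) * (ennreal (r ^ (m + (?n - 1)) * exp (- (r\<^sup>2 * 1 / 2))) * indicator {0..} r) \<partial>lborel)"
    proof -
      obtain p where p: "?n = Suc p" using zero_less_card_finite gr0_conv_Suc by metis
      show ?thesis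
        using c by (intro nn_integral_cong) (auto simp: p indicator_def ennreal_mult[symmetric] power_add mult_ac)
    qed
    also have "\<dots> = ennreal (c * ?n) * ennreal (half_moment (m + (?n - 1)))"
      by (subst nn_integral_cmult, measurable, subst nn_integral_gauss_half_line) auto
    finally show ?thesis
      using c half_moment_pos[of "m + (?n - 1)"]
      by (subst ennreal_mult) (auto simp only: mult_ac intro!: mult_nonneg_nonneg less_imp_le, auto)
  qed
  have vol: "ennreal (c * ?n * half_moment (?n - 1)) * vol = 1"
    using radial[of "\<lambda>_. 1" 0] prob_space.emeasure_space_1[OF prob_space_gauss[where 'n = 'n]]
    by (simp add: vol_def)
  have "(\<integral>\<^sup>+y. ennreal (1 / (norm (g_field \<mu> y)) ^ (2 * k)) \<partial>gauss) = (\<integral>\<^sup>+x. ennreal (norm x ^ (2 * k)) * G x \<partial>gauss)"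
  proof (rule nn_integral_cong_AE, use AE_gauss_inv_energy in eventually_elim)
    case (elim y)
    then have "y \<noteq> 0" using inner_self_g_field by fastforce
    with elim show ?case by (simp add: G_def ennreal_mult[symmetric] power_mult_distrib power_divide)
  qed
  also have "\<dots> = ennreal (c * ?n * half_moment (2 * k + (?n - 1))) * C"
    unfolding C_def by (rule radial) (auto simp: deg0 le1)
  finally have C: "ennreal (c * ?n * half_moment (2 * k + (?n - 1))) * C = ennreal (fact (2 * j + 1) / (2 ^ j * fact j))"
    using gauss_moment_g_field[of j] Suc by simp
  have hm: "half_moment (2 * k + (?n - 1)) = 2 ^ k * pochhammer (real ?n / 2) k * half_moment (?n - 1)" for k
  proof (induction k)
    case (Suc k)
    have "half_moment (2 * Suc k + (?n - 1)) = (real (2 * k + (?n - 1)) + 1) * half_moment (2 * k + (?n - 1))"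
      using half_moment_rec[of "2 * k + (?n - 1)"] by (simp add: add.commute)
    also have "real (2 * k + (?n - 1)) + 1 = 2 * (real ?n / 2 + real k)"
      by (simp add: of_nat_diff Suc_leI)
    finally show ?case unfolding Suc.IH pochhammer_Suc power_Suc by (simp only: mult_ac)
  qed simp
  \<comment> \<open>\<open>(2j+1)! / (2^j j!)\<close> is the double factorial \<open>(2j+1)!!\<close>, the
    normal moment of order \<open>2j+2\<close>.\<close>
  have ff: "fact (2 * j + 1) / (2 ^ j * fact j) = 2 ^ Suc j * pochhammer (1 / 2 :: real) (Suc j)" for j
  proof (induction j)
    case 0 show ?case by simp
  next
    case (Suc j)
    have "fact (2 * Suc j + 1) / (2 ^ Suc j * fact (Suc j)) = (2 * real j + 3) * (fact (2 * j + 1) / (2 ^ j * fact j))"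
      by (simp add: divide_simps)
    also have "\<dots> = 2 ^ Suc (Suc j) * pochhammer (1 / 2 :: real) (Suc (Suc j))"
      unfolding Suc.IH by (subst (2) pochhammer_Suc) (simp add: field_simps)
    finally show ?case .
  qed
  define A where "A = c * ?n * half_moment (?n - 1)"
  have A: "0 < A" using c half_moment_pos by (simp add: A_def)
  have pn: "0 < pochhammer (real ?n / 2) k" by (intro pochhammer_pos) simp
  have "(\<integral>\<^sup>+u. ennreal ((1 / (norm (g_field \<mu> u))\<^sup>2) ^ k) \<partial>sphere_uniform) = (\<integral>\<^sup>+u. G u \<partial>sphere_uniform)"
  proof (rule nn_integral_cong_AE, use finite_energy AE_sphere_uniform in eventually_elim)
    case (elim u)
    then show ?case by (auto simp: G_def power_mult power_divide)
  qed
  also have "\<dots> = C / vol"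
    unfolding C_def vol_def by (rule nn_integral_sphere_uniform) (auto simp: deg0)
  also have "C / vol = ennreal (pochhammer (1 / 2) k / pochhammer (real ?n / 2) k)"
  proof -
    have vol': "vol = ennreal (1 / A)"
    proof -
      have "vol = ennreal (1 / A) * (ennreal A * vol)"
        using A by (simp add: mult.assoc[symmetric] ennreal_mult[symmetric])
      then show ?thesis using vol by (simp add: A_def)
    qed
    define B where "B = 2 ^ k * pochhammer (real ?n / 2) k * A"
    have B: "0 < B" using A pn by (simp add: B_def)
    have "c * ?n * half_moment (2 * k + (?n - 1)) = B"
      unfolding hm A_def B_def by (simp add: mult_ac)
    then have CB: "ennreal B * C = ennreal (2 ^ k * pochhammer (1 / 2 :: real) k)"
      using C ff[of j] Suc by simp
    have "C = ennreal (1 / B) * (ennreal B * C)"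
      using B by (simp add: mult.assoc[symmetric] ennreal_mult[symmetric])
    also have "\<dots> = ennreal (2 ^ k * pochhammer (1 / 2 :: real) k / B)"
      unfolding CB using B by (simp add: ennreal_mult'[symmetric])
    finally have C': "C = ennreal (2 ^ k * pochhammer (1 / 2 :: real) k / B)" .
    have "C / vol = ennreal ((2 ^ k * pochhammer (1 / 2 :: real) k / B) / (1 / A))"
      unfolding vol' C' using A B
      by (intro divide_ennreal) (auto intro!: divide_nonneg_nonneg mult_nonneg_nonneg pochhammer_nonneg)
    also have "(2 ^ k * pochhammer (1 / 2 :: real) k / B) / (1 / A) = pochhammer (1 / 2) k / pochhammer (real ?n / 2) k"
      using A by (simp add: B_def)
    finally show ?thesis .
  qed
  finally have "(\<integral>\<^sup>+u. ennreal ((1 / (norm (g_field \<mu> u))\<^sup>2) ^ k) \<partial>sphere_uniform)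
      = ennreal (pochhammer (1 / 2) k / pochhammer (real ?n / 2) k)" .
  moreover have "0 \<le> pochhammer (1 / 2) k / pochhammer (real ?n / 2) k"
    using pn by (intro divide_nonneg_nonneg pochhammer_nonneg) auto
  ultimately show ?thesis
    by (subst integral_eq_nn_integral) auto
qed

end

section \<open>Beta moments and determinacy\<close>

lemma Beta_half_pos: "0 < b \<Longrightarrow> 0 < Beta (1/2) (b::real)"
  by (simp add: Beta_def Gamma_real_pos)

text \<open>
  Multiplying the density by \<open>x\<^sup>k\<close> shifts the first Beta parameter by \<open>k\<close>; the quotient of the two Beta
  values is computed by the recursion in that parameter.
\<close>

lemma beta_moment:
  fixes b :: real
  assumes b: "0 < b"
  shows "has_bochner_integral lborel (\<lambda>x. beta_density (1/2) b x * x ^ k) (pochhammer (1/2) k / pochhammer (1/2 + b) k)"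
proof -
  have "((\<lambda>t. t powr (1/2 + real k - 1) * (1 - t) powr (b - 1)) has_integral Beta (1/2 + real k) b) {0..1}"
    using b by (intro has_integral_Beta_real) auto
  then have "((\<lambda>t. beta_density (1/2) b t * t ^ k) has_integral Beta (1/2 + real k) b / Beta (1/2) b) {0<..<1}"
    unfolding has_integral_Icc_iff_Ioo
    by (rule has_integral_eq[rotated, OF has_integral_divide])
      (auto simp: beta_density_def powr_realpow[symmetric] powr_add[symmetric] mult_ac)
  then have hi: "((\<lambda>t. beta_density (1/2) b t * t ^ k) has_integral Beta (1/2 + real k) b / Beta (1/2) b) UNIV"
    by (rule has_integral_on_superset) (auto simp: beta_density_def)
  have B: "0 < Beta (1/2) b" using b by (rule Beta_half_pos)
  have nn: "0 \<le> beta_density (1/2) b t * t ^ k" for t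
    using B by (auto simp: beta_density_def)
  have [measurable]: "(\<lambda>t. beta_density (1/2) b t * t ^ k) \<in> borel_measurable borel"
    unfolding beta_density_def by measurable
  have "has_bochner_integral lborel (\<lambda>t. beta_density (1/2) b t * t ^ k) (Beta (1/2 + real k) b / Beta (1/2) b)"
    using has_integral_nonneg[OF hi] nn
    by (intro has_bochner_integral_nn_integral nn_integral_has_integral_lborel hi) auto
  moreover have "Beta (1/2 + real k) b / Beta (1/2) b = pochhammer (1/2) k / pochhammer (1/2 + b) k"
  proof (induction k)
    case (Suc k)
    have "(1/2 + real k + b) * Beta (1/2 + real k + 1) b = (1/2 + real k) * Beta (1/2 + real k) b"
      using b by (intro Beta_plus1_left) (auto dest: nonpos_Ints_nonpos)
    then have "Beta (1/2 + real (Suc k)) b = (1/2 + real k) / (1/2 + b + real k) * Beta (1/2 + real k) b"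
      using b by (simp add: field_simps)
    then have "Beta (1/2 + real (Suc k)) b / Beta (1/2) b
        = (1/2 + real k) / (1/2 + b + real k) * (Beta (1/2 + real k) b / Beta (1/2) b)" by simp
    also have "\<dots> = pochhammer (1/2) (Suc k) / pochhammer (1/2 + b) (Suc k)"
      by (simp only: Suc.IH pochhammer_Suc times_divide_times_eq mult_ac)
    finally show ?case .
  qed (use B in simp)
  ultimately show ?thesis by simp
qed

text \<open>
  The characteristic function of a law on \<open>[-1, 1]\<close> is the sum of its moment series.
\<close>

lemma bounded_moment_determinacy:
  fixes M N :: "real measure"
  assumes "real_distribution M" "real_distribution N"
    and M: "AE x in M. \<bar>x\<bar> \<le> 1" and N: "AE x in N. \<bar>x\<bar> \<le> 1"
    and mom: "\<And>k. (\<integral>x. x ^ k \<partial>M) = (\<integral>x. x ^ k \<partial>N)"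
  shows "M = N"
proof (rule Levy_uniqueness[OF assms(1,2)], rule ext)
  fix t :: real
  let ?p = "\<lambda>n. \<Sum>k\<le>n. ((\<i> * t) ^ k / fact k) * complex_of_real (\<integral>x. x ^ k \<partial>M)"
  have lim: "?p \<longlonglongrightarrow> char L t"
    if "real_distribution L" and L: "AE x in L. \<bar>x\<bar> \<le> 1" and eq: "\<And>k. (\<integral>x. x ^ k \<partial>M) = (\<integral>x. x ^ k \<partial>L)" for L :: "real measure"
  proof -
    interpret L: real_distribution L by fact
    have "AE x in L. \<bar>x\<bar> ^ k \<le> 1" for k
      using L by eventually_elim (simp add: power_le_one)
    then have i: "integrable L (\<lambda>x. x ^ k)" and ia: "integrable L (\<lambda>x. \<bar>x\<bar> ^ k)" for k
      by (auto intro!: L.integrable_const_bound[where B = 1] simp: power_abs)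
    have e1: "(\<integral>x. \<bar>x\<bar> ^ k \<partial>L) \<le> 1" for k
    proof -
      have "(\<integral>x. \<bar>x\<bar> ^ k \<partial>L) \<le> (\<integral>x. 1 \<partial>L)"
        using \<open>AE x in L. \<bar>x\<bar> ^ k \<le> 1\<close> by (intro integral_mono_AE ia) auto
      then show ?thesis using L.prob_space by simp
    qed
    have "norm (?p n - char L t) \<le> 2 * \<bar>t\<bar> ^ n / fact n" for n
    proof -
      have "norm (char L t - ?p n) \<le> 2 * \<bar>t\<bar> ^ n / fact n * (\<integral>x. \<bar>x\<bar> ^ n \<partial>L)"
        using L.char_approx1[of n t] i unfolding eq by simp
      also have "\<dots> \<le> 2 * \<bar>t\<bar> ^ n / fact n" using e1[of n] by (intro mult_left_le) auto
      finally show ?thesis by (simp add: norm_minus_commute)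
    qed
    moreover have "(\<lambda>n. 2 * \<bar>t\<bar> ^ n / fact n) \<longlonglongrightarrow> 0"
      using tendsto_mult_left[OF summable_LIMSEQ_zero[OF summable_exp[of "\<bar>t\<bar>"]], of 2]
      by (simp add: field_simps)
    ultimately show ?thesis
      by (intro LIM_zero_cancel[of _ "char L t"] Lim_null_comparison[where f = "\<lambda>n. ?p n - char L t"]) auto
  qed
  show "char M t = char N t"
    using lim[OF assms(1) M] lim[OF assms(2) N mom] LIMSEQ_unique by blast
qed

section \<open>The law of the inverse squared field norm\<close>

text \<open>
  Both laws are carried by \<open>[0, 1]\<close> and have the same moments.
\<close>

lemma (in finite_energy_measure) distr_inverse_norm_g_field:
  assumes n: "CARD('n) \<ge> 2"
  shows "distr sphere_uniform borel (\<lambda>u. 1 / (norm (g_field \<mu> u))\<^sup>2)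
    = density lborel (\<lambda>x. ennreal (beta_density (1/2) ((real CARD('n) - 1) / 2) x))" (is "?M = ?N")
proof (rule bounded_moment_determinacy)
  let ?b = "(real CARD('n) - 1) / 2"
  have b: "0 < ?b" using n by simp
  interpret su: prob_space "sphere_uniform :: (real ^ 'n) measure" by (rule prob_space_sphere_uniform)
  have [measurable]: "beta_density (1/2) ?b \<in> borel_measurable borel"
    unfolding beta_density_def[abs_def] by measurable
  have "0 < Beta (1/2) ?b" using b by (rule Beta_half_pos)
  then have nn: "0 \<le> beta_density (1/2) ?b x" for x
    by (auto simp: beta_density_def)
  note mom = beta_moment[OF b]
  have "prob_space ?N"
  proof
    have "emeasure ?N (space ?N) = (\<integral>\<^sup>+x. ennreal (beta_density (1/2) ?b x) \<partial>lborel)"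
      by (simp add: emeasure_density)
    also have "\<dots> = 1"
      using mom[of 0] nn by (simp add: nn_integral_eq_integral has_bochner_integral_iff)
    finally show "emeasure ?N (space ?N) = 1" .
  qed
  then show "real_distribution ?N"
    by (simp add: real_distribution_def real_distribution_axioms_def)
  show "real_distribution ?M"
    by (simp add: real_distribution_def real_distribution_axioms_def su.prob_space_distr)
  have "AE u in sphere_uniform. \<bar>1 / (norm (g_field \<mu> u))\<^sup>2\<bar> \<le> 1"
    using finite_energy AE_sphere_uniform
  proof eventually_elim
    case (elim u)
    then have "1 \<le> norm (g_field \<mu> u)" by (intro one_le_norm_g_field) auto
    then have "1 \<le> (norm (g_field \<mu> u))\<^sup>2" by (simp add: one_le_power)
    then show ?case by (simp add: divide_le_eq)
  qed
  then show "AE x in ?M. \<bar>x\<bar> \<le> 1"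
    by (subst AE_distr_iff) auto
  show "AE x in ?N. \<bar>x\<bar> \<le> 1"
    by (subst AE_density) (auto simp: beta_density_def)
  show "(\<integral>x. x ^ k \<partial>?M) = (\<integral>x. x ^ k \<partial>?N)" for k
  proof -
    have "(\<integral>x. x ^ k \<partial>?M) = pochhammer (1/2) k / pochhammer (real CARD('n) / 2) k"
      by (subst integral_distr) (auto simp: sphere_moment_g_field)
    also have "real CARD('n) / 2 = 1/2 + ?b" by (simp add: field_simps)
    also have "pochhammer (1/2) k / pochhammer (1/2 + ?b) k = (\<integral>x. x ^ k \<partial>?N)"
      using mom[of k] nn by (subst integral_density) (auto simp: has_bochner_integral_iff)
    finally show ?thesis .
  qed
qed

section \<open>Finite energy of mixtures of small caps\<close>

text \<open>
  The identity holds for indicators and passes to sums, multiples and increasing limits.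
\<close>

lemma nn_integral_countable_mixture:
  fixes w :: "nat \<Rightarrow> ennreal"
  assumes mix: "\<And>A. A \<in> sets \<mu> \<Longrightarrow> emeasure \<mu> A = (\<Sum>j. w j * emeasure (\<nu> j) A)"
    and s [measurable_cong]: "\<And>j. sets (\<nu> j) = sets \<mu>"
    and f: "f \<in> borel_measurable \<mu>"
  shows "(\<integral>\<^sup>+x. f x \<partial>\<mu>) = (\<Sum>j. w j * (\<integral>\<^sup>+x. f x \<partial>\<nu> j))"
proof -
  have sp: "space (\<nu> j) = space \<mu>" for j by (rule sets_eq_imp_space_eq[OF s])
  show ?thesis using f
  proof (induction rule: borel_measurable_induct)
    case (cong f g)
    have h: "(\<integral>\<^sup>+x. f x \<partial>\<mu>) = (\<integral>\<^sup>+x. g x \<partial>\<mu>)" "(\<integral>\<^sup>+x. f x \<partial>\<nu> j) = (\<integral>\<^sup>+x. g x \<partial>\<nu> j)" for j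
      by (rule nn_integral_cong, rule cong(3), simp add: sp)+
    show ?case unfolding h by (rule cong)
  next
    case (set A)
    then show ?case by (simp add: mix s)
  next
    case (mult u c)
    note [measurable] = mult.hyps(2)
    have "(\<integral>\<^sup>+x. c * u x \<partial>\<nu> j) = c * (\<integral>\<^sup>+x. u x \<partial>\<nu> j)" for j
      by (rule nn_integral_cmult) measurable
    then show ?case
      by (simp add: nn_integral_cmult mult.IH mult.left_commute[of _ c])
  next
    case (add u v)
    note [measurable] = add.hyps(1,3)
    have "(\<integral>\<^sup>+x. v x + u x \<partial>\<nu> j) = (\<integral>\<^sup>+x. v x \<partial>\<nu> j) + (\<integral>\<^sup>+x. u x \<partial>\<nu> j)" for j
      by (rule nn_integral_add) measurable
    then show ?case
      by (simp add: nn_integral_add add.IH distrib_left suminf_add[symmetric])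
  next
    case (seq U)
    note [measurable] = seq.hyps(1)
    have sup: "(SUP i. U i) x = (SUP i. U i x)" for x by (simp add: image_image)
    have "(\<integral>\<^sup>+x. (SUP i. U i) x \<partial>\<mu>) = (SUP i. \<integral>\<^sup>+x. U i x \<partial>\<mu>)"
      unfolding sup by (rule nn_integral_monotone_convergence_SUP[OF seq.hyps(3)]) measurable
    also have "\<dots> = (SUP i. \<Sum>j. w j * (\<integral>\<^sup>+x. U i x \<partial>\<nu> j))"
      by (simp add: seq.IH)
    also have "\<dots> = (\<Sum>j. SUP i. w j * (\<integral>\<^sup>+x. U i x \<partial>\<nu> j))"
      using seq.hyps(3)
      by (intro ennreal_suminf_SUP_eq[symmetric]) (auto simp: incseq_def le_fun_def intro!: mult_left_mono nn_integral_mono)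
    also have "\<dots> = (\<Sum>j. w j * (SUP i. \<integral>\<^sup>+x. U i x \<partial>\<nu> j))"
      by (simp add: SUP_mult_left_ennreal)
    also have "\<dots> = (\<Sum>j. w j * (\<integral>\<^sup>+x. (SUP i. U i) x \<partial>\<nu> j))"
      unfolding sup by (subst nn_integral_monotone_convergence_SUP[OF seq.hyps(3)]) measurable
    finally show ?case .
  qed
qed

lemma std_normal_density_le_1: "std_normal_density x \<le> 1"
proof -
  have "1 \<le> sqrt (2 * pi)" using pi_gt3 by simp
  moreover have "exp (- x\<^sup>2 / 2) \<le> 1" by simp
  ultimately have "exp (- x\<^sup>2 / 2) \<le> sqrt (2 * pi)" by linarith
  then show ?thesis
    unfolding std_normal_density_def by (simp add: divide_le_eq)
qed

lemma nn_integral_std_normal_le_lborel: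
  assumes [measurable]: "f \<in> borel_measurable borel"
  shows "(\<integral>\<^sup>+x. f x \<partial>std_normal_distribution) \<le> (\<integral>\<^sup>+x. f x \<partial>lborel)"
proof -
  have "(\<integral>\<^sup>+x. f x \<partial>std_normal_distribution) = (\<integral>\<^sup>+x. ennreal (std_normal_density x) * f x \<partial>lborel)"
    by (rule nn_integral_density) auto
  also have "\<dots> \<le> (\<integral>\<^sup>+x. 1 * f x \<partial>lborel)"
    using std_normal_density_le_1 by (intro nn_integral_mono mult_right_mono) auto
  finally show ?thesis by simp
qed

text \<open>
  The integrand is at most \<open>1\<close> where \<open>\<bar>t\<bar> \<ge> 1\<close>. On \<open>[-1, 1]\<close> the normal density is at most \<open>1\<close>, so
  Lebesgue measure bounds the rest by \<open>2 + 2 ln (1 / r)\<close>.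
\<close>

lemma std_normal_truncated_inverse_moment:
  assumes r: "0 < r" "r \<le> 1"
  shows "(\<integral>\<^sup>+t. ennreal (1 / max r \<bar>t\<bar>) \<partial>std_normal_distribution) \<le> ennreal (3 * ln (exp 1 / r))"
proof -
  interpret prob_space std_normal_distribution by (rule prob_space_normal_density) simp
  have lr: "ln r \<le> 0" using r by simp
  let ?f1 = "\<lambda>t. ennreal (1 / r) * indicator {-r..r} t"
  let ?f2 = "\<lambda>t. ennreal (1 / t) * indicator {r..1} t"
  let ?f3 = "\<lambda>t. ennreal (1 / (- t)) * indicator {-1..-r} t"
  have pt: "ennreal (1 / max r \<bar>t\<bar>) \<le> 1 + (?f1 t + (?f2 t + ?f3 t))" for t
  proof -
    consider "\<bar>t\<bar> \<ge> 1" | "\<bar>t\<bar> \<le> r" | "r \<le> t" "t \<le> 1" | "-1 \<le> t" "t \<le> -r" by linarith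
    then show ?thesis
    proof cases
      case 1
      then have "1 / max r \<bar>t\<bar> \<le> 1" using r by (simp add: divide_le_eq max_def)
      then have "ennreal (1 / max r \<bar>t\<bar>) \<le> 1" by simp
      then show ?thesis by (rule order_trans) simp
    next
      case 2
      then have "ennreal (1 / max r \<bar>t\<bar>) \<le> ?f1 t" using r by (auto simp: max_def indicator_def abs_le_iff intro!: frac_le)
      then show ?thesis by (meson add_increasing add_increasing2 order_trans zero_le)
    next
      case 3
      then have "ennreal (1 / max r \<bar>t\<bar>) \<le> ?f2 t" using r by (auto simp: max_def)
      then show ?thesis by (meson add_increasing add_increasing2 order_trans zero_le)
    next
      case 4
      then have "ennreal (1 / max r \<bar>t\<bar>) \<le> ?f3 t" using r by (auto simp: max_def)
      then show ?thesis by (meson add_increasing add_increasing2 order_trans zero_le)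
    qed
  qed
  have i1: "(\<integral>\<^sup>+t. ?f1 t \<partial>lborel) = ennreal 2"
    using r by (subst nn_integral_cmult_indicator) (auto simp: ennreal_mult[symmetric])
  have i2: "(\<integral>\<^sup>+t. ?f2 t \<partial>lborel) = ennreal (ln 1 - ln r)"
    using r by (intro nn_integral_FTC_Icc) (auto intro!: derivative_eq_intros)
  have i3: "(\<integral>\<^sup>+t. ?f3 t \<partial>lborel) = ennreal ((- ln (- (- r))) - (- ln (- (- 1))))"
    using r by (intro nn_integral_FTC_Icc) (auto intro!: derivative_eq_intros simp: field_simps)
  have "(\<integral>\<^sup>+t. ennreal (1 / max r \<bar>t\<bar>) \<partial>std_normal_distribution)
      \<le> (\<integral>\<^sup>+t. 1 + (?f1 t + (?f2 t + ?f3 t)) \<partial>std_normal_distribution)"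
    by (intro nn_integral_mono pt)
  also have "\<dots> = 1 + (\<integral>\<^sup>+t. ?f1 t + (?f2 t + ?f3 t) \<partial>std_normal_distribution)"
    using emeasure_space_1 by (subst nn_integral_add) auto
  also have "\<dots> \<le> 1 + (\<integral>\<^sup>+t. ?f1 t + (?f2 t + ?f3 t) \<partial>lborel)"
    by (intro add_left_mono nn_integral_std_normal_le_lborel) measurable
  also have "(\<integral>\<^sup>+t. ?f1 t + (?f2 t + ?f3 t) \<partial>lborel) = ennreal 2 + (ennreal (ln 1 - ln r) + ennreal ((- ln (- (- r))) - (- ln (- (- 1)))))"
    unfolding i1[symmetric] i2[symmetric] i3[symmetric]
    by (subst nn_integral_add, measurable, subst nn_integral_add) auto
  also have "1 + \<dots> = ennreal 1 + (ennreal 2 + (ennreal (- ln r) + ennreal (- ln r)))"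
    by simp
  also have "\<dots> = ennreal (1 + (2 + (- ln r + - ln r)))"
    using lr by (simp only: ennreal_plus[symmetric] add_nonneg_nonneg neg_0_le_iff_le zero_le_one zero_le_numeral)
  also have "\<dots> \<le> ennreal (3 * ln (exp 1 / r))"
  proof (rule ennreal_leI)
    have "ln (exp 1 / r) = 1 - ln r" using r by (simp add: ln_div)
    then show "1 + (2 + (- ln r + - ln r)) \<le> 3 * ln (exp 1 / r)" using lr by linarith
  qed
  finally show ?thesis .
qed

text \<open>
  Off the shadow \<open>\<bar>a \<bullet> u\<bar>\<close> has a positive minimum on the compact set \<open>K\<close>.
\<close>

lemma inv_energy_finite_off_shadow:
  fixes \<nu> :: "(real ^ 'n) measure"
  assumes "prob_space \<nu>" "sets \<nu> = sets borel" and K: "compact K" "emeasure \<nu> K = 1"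
    and u: "norm u = 1" "u \<notin> orthogonality_shadow K"
  shows "inv_energy \<nu> u < \<infinity>"
proof -
  interpret prob_space \<nu> by fact
  have "K \<noteq> {}" using K(2) by auto
  moreover have "continuous_on K (\<lambda>a. \<bar>a \<bullet> u\<bar>)" by (intro continuous_intros)
  ultimately obtain a0 where a0: "a0 \<in> K" "\<And>a. a \<in> K \<Longrightarrow> \<bar>a0 \<bullet> u\<bar> \<le> \<bar>a \<bullet> u\<bar>"
    using continuous_attains_inf[OF K(1)] by blast
  have pos: "0 < \<bar>a0 \<bullet> u\<bar>" using u a0(1) by (auto simp: orthogonality_shadow_def)
  have Ks: "K \<in> sets \<nu>" using K(2) emeasure_notin_sets by fastforce
  have AE_K: "AE a in \<nu>. a \<in> K"
    using AE_prob_1[of K] K(2) by (simp add: emeasure_eq_measure Ks)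
  have "inv_energy \<nu> u \<le> (\<integral>\<^sup>+a. ennreal (1 / \<bar>a0 \<bullet> u\<bar>) \<partial>\<nu>)"
    unfolding inv_energy_def
  proof (rule nn_integral_mono_AE, use AE_K in eventually_elim)
    case (elim a)
    have "1 / ennreal \<bar>a \<bullet> u\<bar> = ennreal (1 / \<bar>a \<bullet> u\<bar>)"
      using pos a0(2)[OF elim] by (subst divide_ennreal[symmetric]) auto
    then show ?case using pos a0(2)[OF elim] by (simp add: frac_le ennreal_leI)
  qed
  also have "\<dots> < \<infinity>" by (simp add: emeasure_space_1)
  finally show ?thesis .
qed

lemma AE_lborel_of_AE_sphere_uniform:
  fixes P :: "real ^ 'n \<Rightarrow> bool"
  assumes "AE u in sphere_uniform. P u"
  shows "AE x in lborel. norm x < 1 \<longrightarrow> P (x /\<^sub>R norm x)"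
proof -
  have "AE x in uniform_measure lborel (ball (0 :: real ^ 'n) 1). P (x /\<^sub>R norm x)"
    using assms unfolding sphere_uniform_def by (rule AE_distrD[rotated]) simp
  then have "AE x in lborel. x \<in> ball (0 :: real ^ 'n) 1 \<longrightarrow> P (x /\<^sub>R norm x)"
    using emeasure_unit_ball[where 'n = 'n] by (subst (asm) AE_uniform_measure) (auto simp: less_top)
  then show ?thesis by simp
qed

lemma AE_gauss_iff_AE_lborel: "(AE x in gauss. P x) \<longleftrightarrow> (AE x in lborel. P x)"
  unfolding gauss_eq by (subst AE_density) auto

lemma gauss_slab:
  fixes a :: "real ^ 'n"
  assumes a: "norm a = 1" and r: "0 \<le> r"
  shows "measure gauss {y. \<bar>a \<bullet> y\<bar> < r} \<le> 2 * r"
proof -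
  interpret prob_space "gauss :: (real ^ 'n) measure" by (rule prob_space_gauss)
  have "emeasure gauss {y. \<bar>a \<bullet> y\<bar> < r} = emeasure std_normal_distribution {-r<..<r}"
    unfolding gauss_marginal[OF a, symmetric]
    by (subst emeasure_distr) (auto intro!: arg_cong2[where f = emeasure])
  also have "\<dots> \<le> emeasure lborel {-r<..<r}"
    using nn_integral_std_normal_le_lborel[of "indicator {-r<..<r}"] by simp
  also have "\<dots> = ennreal (2 * r)" using r by simp
  finally show ?thesis using r by (simp add: emeasure_eq_measure)
qed

text \<open>
  The Gaussian mean of the sum is at most \<open>3 \<Sum> w\<^sub>j ln (e / \<rho>\<^sub>j)\<close>.
\<close>

lemma AE_suminf_small_caps_finite:
  fixes a :: "nat \<Rightarrow> real ^ 'n" and \<rho> w :: "nat \<Rightarrow> real"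
  assumes w: "\<And>j. 0 \<le> w j" and a: "\<And>j. norm (a j) = 1" and \<rho>: "\<And>j. 0 < \<rho> j" "\<And>j. \<rho> j \<le> 1"
    and sum: "summable (\<lambda>j. w j * ln (exp 1 / \<rho> j))"
  shows "AE y in gauss. (\<Sum>j. ennreal (w j) * ennreal (1 / max (\<rho> j) \<bar>a j \<bullet> y\<bar>)) < \<infinity>"
proof -
  have b: "(\<integral>\<^sup>+y. ennreal (1 / max (\<rho> j) \<bar>a j \<bullet> y\<bar>) \<partial>gauss) \<le> ennreal (3 * ln (exp 1 / \<rho> j))" for j
  proof -
    have "(\<integral>\<^sup>+y. ennreal (1 / max (\<rho> j) \<bar>a j \<bullet> y\<bar>) \<partial>gauss) = (\<integral>\<^sup>+t. ennreal (1 / max (\<rho> j) \<bar>t\<bar>) \<partial>std_normal_distribution)"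
      unfolding gauss_marginal[OF a[of j], symmetric] by (subst nn_integral_distr) auto
    also have "\<dots> \<le> ennreal (3 * ln (exp 1 / \<rho> j))"
      by (rule std_normal_truncated_inverse_moment[OF \<rho>])
    finally show ?thesis .
  qed
  have l: "0 \<le> ln (exp 1 / \<rho> j)" for j
  proof -
    have "ln (\<rho> j) \<le> 0" using \<rho>[of j] by simp
    moreover have "ln (exp 1 / \<rho> j) = 1 - ln (\<rho> j)" using \<rho>(1)[of j] by (simp add: ln_div)
    ultimately show ?thesis by linarith
  qed
  have "(\<integral>\<^sup>+y. (\<Sum>j. ennreal (w j) * ennreal (1 / max (\<rho> j) \<bar>a j \<bullet> y\<bar>)) \<partial>gauss)
      = (\<Sum>j. ennreal (w j) * (\<integral>\<^sup>+y. ennreal (1 / max (\<rho> j) \<bar>a j \<bullet> y\<bar>) \<partial>gauss))"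
    by (simp add: nn_integral_suminf nn_integral_cmult)
  also have "\<dots> \<le> (\<Sum>j. ennreal (w j) * ennreal (3 * ln (exp 1 / \<rho> j)))"
    by (intro suminf_le mult_left_mono b) auto
  also have "\<dots> = (\<Sum>j. ennreal (3 * (w j * ln (exp 1 / \<rho> j))))"
    using w l by (simp add: ennreal_mult[symmetric] mult_ac)
  also have "\<dots> < \<infinity>"
    using w l sum by (subst suminf_ennreal2) (auto intro!: summable_mult)
  finally have "(\<integral>\<^sup>+y. (\<Sum>j. ennreal (w j) * ennreal (1 / max (\<rho> j) \<bar>a j \<bullet> y\<bar>)) \<partial>gauss) \<noteq> \<infinity>" by simp
  from nn_integral_noteq_infinite[OF _ this] show ?thesis
    by (auto simp: less_top)
qed

text \<open>
  If \<open>y\<close> is far from the hyperplane orthogonal to the centre, on the scale of the cap, then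
  \<open>\<bar>b \<bullet> y\<bar>\<close> is at least half of \<open>\<bar>a \<bullet> y\<bar>\<close> for all \<open>b\<close> in the cap. The maximum in the bound is
  \<open>\<bar>a \<bullet> y\<bar>\<close>; in the form with \<open>max\<close> its Gaussian mean is finite.
\<close>

lemma inv_energy_small_cap:
  fixes \<nu> :: "(real ^ 'n) measure"
  assumes "prob_space \<nu>" "sets \<nu> = sets borel" "K \<in> sets borel" "emeasure \<nu> K = 1"
    and cap: "K \<subseteq> cball a \<rho>" and y: "norm y \<le> 1" and \<rho>: "0 < \<rho>" and far: "2 * \<rho> \<le> \<bar>a \<bullet> y\<bar>"
  shows "inv_energy \<nu> y \<le> 2 * ennreal (1 / max \<rho> \<bar>a \<bullet> y\<bar>)"
proof -
  interpret prob_space \<nu> by fact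
  have AE_K: "AE b in \<nu>. b \<in> K"
    using AE_prob_1[of K] assms by (simp add: emeasure_eq_measure)
  have "inv_energy \<nu> y \<le> (\<integral>\<^sup>+b. ennreal (2 / \<bar>a \<bullet> y\<bar>) \<partial>\<nu>)"
    unfolding inv_energy_def
  proof (rule nn_integral_mono_AE, use AE_K in eventually_elim)
    case (elim b)
    then have "norm (a - b) \<le> \<rho>" using cap by (auto simp: dist_norm)
    then have "norm (a - b) * norm y \<le> \<rho> * 1" using y \<rho> by (intro mult_mono) auto
    then have "\<bar>(a - b) \<bullet> y\<bar> \<le> \<rho>" using Cauchy_Schwarz_ineq2[of "a - b" y] by simp
    then have le: "\<bar>a \<bullet> y\<bar> / 2 \<le> \<bar>b \<bullet> y\<bar>" using far by (simp add: inner_diff_left)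
    have pos: "0 < \<bar>a \<bullet> y\<bar>" using far \<rho> by linarith
    have "1 / ennreal \<bar>b \<bullet> y\<bar> = ennreal (1 / \<bar>b \<bullet> y\<bar>)"
      using le pos by (subst divide_ennreal[symmetric]) auto
    moreover have "1 / \<bar>b \<bullet> y\<bar> \<le> 1 / (\<bar>a \<bullet> y\<bar> / 2)"
      using le pos by (intro divide_left_mono) auto
    ultimately show ?case by (simp add: ennreal_leI)
  qed
  also have "\<dots> = ennreal (2 * (1 / max \<rho> \<bar>a \<bullet> y\<bar>))"
    using far \<rho> by (simp add: emeasure_space_1 max_def)
  also have "\<dots> = 2 * ennreal (1 / max \<rho> \<bar>a \<bullet> y\<bar>)"
    using \<rho> by (subst ennreal_mult) auto
  finally show ?thesis .
qed

text \<open>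
  The argument runs in the unit ball, where \<open>\<bar>(a - b) \<bullet> y\<bar> \<le> \<parallel>a - b\<parallel>\<close>, with the Gaussian measure supplying
  the probabilities; homogeneity then carries the result to the sphere.
\<close>

lemma inv_energy_mixture_finite:
  fixes \<mu> :: "(real ^ 'n) measure" and \<mu>s :: "nat \<Rightarrow> (real ^ 'n) measure"
  assumes \<mu>: "sphere_measure \<mu>"
    and w: "\<And>j. w j \<ge> 0"
    and ps: "\<And>j. prob_space (\<mu>s j)" and s: "\<And>j. sets (\<mu>s j) = sets borel"
    and Kc: "\<And>j. compact (K j)" and K1: "\<And>j. emeasure (\<mu>s j) (K j) = 1"
    and sh: "\<And>j. orthogonality_shadow (K j) \<in> null_sets sphere_uniform"
    and mix: "\<And>A. A \<in> sets borel \<Longrightarrow> emeasure \<mu> A = (\<Sum>j. ennreal (w j) * emeasure (\<mu>s j) A)"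
    and a: "\<And>j. norm (a j) = 1" and \<rho>: "\<And>j. 0 < \<rho> j" "\<And>j. \<rho> j \<le> 1"
    and cap: "\<And>j. K (Suc j) \<subseteq> cball (a j) (\<rho> j)"
    and sum_\<rho>: "summable \<rho>"
    and sum_w: "summable (\<lambda>j. w (Suc j) * ln (exp 1 / \<rho> j))"
  shows "AE u in sphere_uniform. inv_energy \<mu> u < \<infinity>"
proof -
  interpret \<mu>: sphere_measure \<mu> by fact
  interpret g: prob_space "gauss :: (real ^ 'n) measure" by (rule prob_space_gauss)
  let ?A = "\<lambda>j. {y. \<bar>a j \<bullet> y\<bar> < 2 * \<rho> j}"
  have "AE y in gauss. eventually (\<lambda>j. y \<in> space gauss - ?A j) sequentially"
  proof (rule borel_cantelli_AE1)
    show "?A j \<in> sets gauss" for j by measurable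
    show "emeasure gauss (?A j) < \<infinity>" for j by (simp add: g.emeasure_eq_measure)
    show "summable (\<lambda>j. measure gauss (?A j))"
    proof (rule summable_comparison_test')
      show "summable (\<lambda>j. 4 * \<rho> j)" using sum_\<rho> by (rule summable_mult)
      show "norm (measure gauss (?A j)) \<le> 4 * \<rho> j" if "0 \<le> j" for j
        using gauss_slab[OF a[of j], of "2 * \<rho> j"] \<rho>(1)[of j] by simp
    qed
  qed
  moreover have "AE y in gauss. (\<Sum>j. ennreal (w (Suc j)) * ennreal (1 / max (\<rho> j) \<bar>a j \<bullet> y\<bar>)) < \<infinity>"
    by (rule AE_suminf_small_caps_finite) (use w a \<rho> sum_w in auto)
  moreover have "AE y in gauss. norm y < 1 \<longrightarrow> (\<forall>j. y /\<^sub>R norm y \<notin> orthogonality_shadow (K j))"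
    unfolding AE_gauss_iff_AE_lborel using sh
    by (intro AE_lborel_of_AE_sphere_uniform) (auto simp: AE_all_countable intro: AE_not_in)
  moreover have "AE y in gauss. y \<noteq> 0"
    unfolding AE_gauss_iff_AE_lborel by (rule AE_lborel_singleton)
  ultimately have "AE y in gauss. norm y < 1 \<longrightarrow> inv_energy \<mu> y < \<infinity>"
  proof eventually_elim
    case (elim y)
    show ?case
    proof
      assume y: "norm y < 1"
      let ?t = "\<lambda>j. ennreal (w j) * inv_energy (\<mu>s j) y"
      have each: "?t j < \<infinity>" for j
      proof -
        have fin: "inv_energy (\<mu>s j) (y /\<^sub>R norm y) < \<infinity>"
          using elim y by (intro inv_energy_finite_off_shadow[OF ps s Kc K1]) auto
        have "inv_energy (\<mu>s j) y < \<infinity>"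
          using inv_energy_scale[OF s, of "norm y" j "y /\<^sub>R norm y"] fin elim by simp
        then show ?thesis by (simp add: ennreal_mult_less_top)
      qed
      \<comment> \<open>From index N on the cap bound applies; the earlier terms are finite one by one.\<close>
      obtain N where N: "\<And>j. N \<le> j \<Longrightarrow> 2 * \<rho> j \<le> \<bar>a j \<bullet> y\<bar>"
        using elim(1) unfolding eventually_sequentially by (auto simp: not_less)
      have "inv_energy \<mu> y = (\<Sum>j. ?t j)"
        unfolding inv_energy_def
        by (rule nn_integral_countable_mixture) (auto simp: mix s)
      also have "\<dots> = (\<Sum>j. ?t (j + Suc N)) + (\<Sum>j<Suc N. ?t j)"
        by (rule suminf_offset) auto
      also have "\<dots> < \<infinity>"
      proof -
        have "(\<Sum>j. ?t (j + Suc N)) \<le> (\<Sum>j. 2 * (ennreal (w (Suc (j + N))) * ennreal (1 / max (\<rho> (j + N)) \<bar>a (j + N) \<bullet> y\<bar>)))"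
        proof (rule suminf_le)
          fix j
          have "inv_energy (\<mu>s (Suc (j + N))) y \<le> 2 * ennreal (1 / max (\<rho> (j + N)) \<bar>a (j + N) \<bullet> y\<bar>)"
            using y by (intro inv_energy_small_cap[OF ps s _ K1 cap] N \<rho> borel_compact Kc) auto
          then show "?t (j + Suc N) \<le> 2 * (ennreal (w (Suc (j + N))) * ennreal (1 / max (\<rho> (j + N)) \<bar>a (j + N) \<bullet> y\<bar>))"
            by (simp add: mult_left_mono mult.left_commute[of 2])
        qed auto
        also have "\<dots> = 2 * (\<Sum>j. ennreal (w (Suc (j + N))) * ennreal (1 / max (\<rho> (j + N)) \<bar>a (j + N) \<bullet> y\<bar>))"
          by (rule ennreal_suminf_cmult)
        also have "\<dots> \<le> 2 * (\<Sum>j. ennreal (w (Suc j)) * ennreal (1 / max (\<rho> j) \<bar>a j \<bullet> y\<bar>))"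
          by (subst (2) suminf_offset[of _ N]) (auto intro!: mult_left_mono)
        also have "\<dots> < \<infinity>" using elim by (simp add: ennreal_mult_less_top)
        finally show ?thesis using each by simp
      qed
      finally show "inv_energy \<mu> y < \<infinity>" .
    qed
  qed
  then show ?thesis
    unfolding AE_gauss_iff_AE_lborel
    by (subst (asm) AE_lborel_cone_iff_AE_sphere_uniform(2)) (auto simp: inv_energy_scale[OF \<mu>.sets_\<mu>, simplified])
qed

section \<open>The Beta law for mixtures of small caps\<close>

theorem theorem8p6:
  fixes \<mu> :: "(real ^ 'n) measure"
    and \<mu>s :: "nat \<Rightarrow> (real ^ 'n) measure"
    and w \<rho> :: "nat \<Rightarrow> real"
    and K :: "nat \<Rightarrow> (real ^ 'n) set"
    and a :: "nat \<Rightarrow> real ^ 'n"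
    and M :: "'s measure"
    and U :: "'s \<Rightarrow> real ^ 'n"
  assumes "CARD('n) \<ge> 2"
    and "\<And>j. w j \<ge> 0" and "w sums 1"
    and "\<And>j. prob_space (\<mu>s j)" and "\<And>j. sets (\<mu>s j) = sets borel"
    and "\<And>j. compact (K j)" and "\<And>j. K j \<subseteq> sphere 0 1"
    and "\<And>j. emeasure (\<mu>s j) (K j) = 1"
    and "\<And>j. orthogonality_shadow (K j) \<in> null_sets sphere_uniform"
    and "sets \<mu> = sets borel"
    and "\<And>A. A \<in> sets borel \<Longrightarrow>
           emeasure \<mu> A = (\<Sum>j. ennreal (w j) * emeasure (\<mu>s j) A)"
    and "\<And>j. j \<ge> 1 \<Longrightarrow> a j \<in> sphere 0 1"
    and "\<And>j. j \<ge> 1 \<Longrightarrow> 0 < \<rho> j \<and> \<rho> j \<le> 1/4"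
    and "\<And>j. j \<ge> 1 \<Longrightarrow> K j \<subseteq> cball (a j) (\<rho> j)"
    and "summable (\<lambda>j. \<rho> (Suc j))"
    and "summable (\<lambda>j. w (Suc j) * ln (exp 1 / \<rho> (Suc j)))"
    and "prob_space M" and "U \<in> borel_measurable M"
    and "distr M borel U = sphere_uniform"
  shows "(AE \<omega> in M. inv_energy \<mu> (U \<omega>) < \<infinity>) \<and>
         (AE \<omega> in M. 1 / (norm (g_field \<mu> (U \<omega>)))\<^sup>2 = (U \<omega> \<bullet> N_field \<mu> (U \<omega>))\<^sup>2) \<and>
         distributed M lborel (\<lambda>\<omega>. 1 / (norm (g_field \<mu> (U \<omega>)))\<^sup>2)
           (\<lambda>x. ennreal (beta_density (1/2) ((real CARD('n) - 1) / 2) x))"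
proof -
  note n = assms(1) and w = assms(2) and w1 = assms(3) and ps = assms(4) and s = assms(5)
    and Kc = assms(6) and Ks = assms(7) and K1 = assms(8) and sh = assms(9) and s\<mu> = assms(10)
    and mix = assms(11) and U [measurable] = assms(18) and dU = assms(19)
  have prob: "emeasure (\<mu>s j) UNIV = 1" for j
    using prob_space.emeasure_space_1[OF ps[of j]] sets_eq_imp_space_eq[OF s[of j]] by simp
  have "sphere_measure \<mu>"
  proof (intro sphere_measure.intro sphere_measure_axioms.intro s\<mu> prob_spaceI)
    have "emeasure \<mu> UNIV = (\<Sum>j. ennreal (w j))" by (simp add: mix prob)
    also have "\<dots> = 1" using suminf_ennreal_eq[OF w w1] by simp
    finally show "emeasure \<mu> (space \<mu>) = 1" using sets_eq_imp_space_eq[OF s\<mu>] by simp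
    have S: "- sphere (0::real ^ 'n) 1 \<in> sets borel" by (intro borel_open) auto
    have "emeasure (\<mu>s j) (- sphere 0 1) = 0" for j
    proof -
      have "AE x in \<mu>s j. x \<in> K j"
        using prob_space.AE_prob_1[OF ps[of j], of "K j"] K1[of j]
        by (simp add: measure_def)
      then have "AE x in \<mu>s j. x \<notin> - sphere 0 1"
        by eventually_elim (use Ks[of j] in auto)
      then show ?thesis
        using S s[of j] by (subst (asm) AE_iff_measurable[of "- sphere 0 1"]) (auto simp: sets_eq_imp_space_eq[OF s[of j]])
    qed
    then have "- sphere 0 1 \<in> null_sets \<mu>" using S s\<mu> by (simp add: null_sets_def mix)
    from AE_not_in[OF this] show "AE a in \<mu>. norm a = 1" by simp
  qed
  moreover have "AE u in sphere_uniform. inv_energy \<mu> u < \<infinity>"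
  proof (rule inv_energy_mixture_finite[OF \<open>sphere_measure \<mu>\<close> w ps s Kc K1 sh mix])
    fix j
    show "norm (a (Suc j)) = 1" using assms(12)[of "Suc j"] by simp
    show "0 < \<rho> (Suc j)" "\<rho> (Suc j) \<le> 1" using assms(13)[of "Suc j"] by simp_all
    show "K (Suc j) \<subseteq> cball (a (Suc j)) (\<rho> (Suc j))" using assms(14)[of "Suc j"] by simp
  qed (assumption | rule assms(15) assms(16))+
  ultimately interpret finite_energy_measure \<mu>
    by (simp add: finite_energy_measure_def finite_energy_measure_axioms_def)
  have fin: "AE \<omega> in M. inv_energy \<mu> (U \<omega>) < \<infinity>"
    using finite_energy U unfolding dU[symmetric] by (rule AE_distrD[rotated])
  moreover have "AE \<omega> in M. 1 / (norm (g_field \<mu> (U \<omega>)))\<^sup>2 = (U \<omega> \<bullet> N_field \<mu> (U \<omega>))\<^sup>2"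
    using fin by eventually_elim (simp add: N_field_def inner_self_g_field power_divide field_simps)
  moreover have "distr M lborel (\<lambda>\<omega>. 1 / (norm (g_field \<mu> (U \<omega>)))\<^sup>2)
      = distr (distr M borel U) borel (\<lambda>u. 1 / (norm (g_field \<mu> u))\<^sup>2)"
    by (subst distr_distr) (auto simp: comp_def intro!: distr_cong)
  then have "distributed M lborel (\<lambda>\<omega>. 1 / (norm (g_field \<mu> (U \<omega>)))\<^sup>2)
           (\<lambda>x. ennreal (beta_density (1/2) ((real CARD('n) - 1) / 2) x))"
    unfolding distributed_def
    by (auto simp: dU distr_inverse_norm_g_field[OF n] beta_density_def[abs_def])
  ultimately show ?thesis by blast
qed

end
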